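(* Let $G=M\bowtie_\gamma H$ be the cocycle double cross product of a cocycle matched pair $(M,H)$, with Lie algebra $T_oM\bowtie_\theta\mathfrak h$. Given a Hamiltonian $\mathcal H=\mathcal H(\kappa,\lambda,m,h)$ defined on $(T_oM\bowtie_\theta\mathfrak h)^*\rtimes(M\bowtie_\gamma H)$, the (trivialized) Hamilton's equations are given by $$\frac{d\kappa}{dt}=-T^*\mathfrak R_m\Big(\frac{\delta\mathcal H}{\delta m}\Big)-T^*(R_h\circ{}_m\gamma)\Big(\frac{\delta\mathcal H}{\delta h}\Big)+\mathfrak{ad}^*_{\frac{\delta\mathcal H}{\delta\kappa}}(\kappa)-\kappa\overset{*}{\triangleleft}\Big(\frac{\delta\mathcal H}{\delta\lambda}\Big)-\mathfrak a^*_{\frac{\delta\mathcal H}{\delta\lambda}}(\lambda)-\theta^*_{\frac{\delta\mathcal H}{\delta\kappa}}(\lambda),$$ $$\frac{d\lambda}{dt}=-T^*({}_m\varphi)\Big(\frac{\delta\mathcal H}{\delta m}\Big)-T^*(R_h\circ{}_m\sigma)\Big(\frac{\delta\mathcal H}{\delta h}\Big)+\mathrm{ad}^*_{\frac{\delta\mathcal H}{\delta\lambda}}\lambda+\mathfrak b^*_{\frac{\delta\mathcal H}{\delta\kappa}}(\kappa)+{}_{\frac{\delta\mathcal H}{\delta\kappa}}\psi^*(\lambda),$$ $$\frac{dm}{dt}=T\mathfrak R_m\Big(\frac{\delta\mathcal H}{\delta\kappa}\Big)+\Big(\frac{\delta\mathcal H}{\delta\lambda}\Big)\triangleright m,$$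 $$\frac{dh}{dt}=TR_h\Big[T({}_m\gamma)\Big(\frac{\delta\mathcal H}{\delta\kappa}\Big)+T({}_m\sigma)\Big(\frac{\delta\mathcal H}{\delta\lambda}\Big)\Big].$$
   Context: Cocycle matched pair. $M$ is a smooth manifold with a distinguished element $o$, $H$ is a Lie group (product $*$, identity $1$, Lie algebra $\mathfrak h$) with a smooth left action $H\times M\to M$, $(h,m)\mapsto h\triangleright m$, satisfying $h\triangleright o=o$. There are smooth maps $\sigma:H\times M\to H$, $\Phi:M\times M\to M$ (written $m_1\cdot m_2$), $\gamma:M\times M\to H$ with $\sigma(h,o)=h$, $\sigma(1,m)=1$, $\gamma(o,o)=1$, and (i) $o\cdot m=m=m\cdot o$; (ii) $\gamma(m,o)=1=\gamma(o,m)$; (iii) $h\triangleright(m_1\cdot m_2)=(h\triangleright m_1)\cdot(\sigma(h,m_1)\triangleright m_2)$; (iv) $\sigma(h,m_1\cdot m_2)*\gamma(m_1,m_2)=\gamma(h\triangleright m_1,\sigma(h,m_1)\triangleright m_2)*\sigma(\sigma(h,m_1),m_2)$; (v) $\sigma(h_1*h_2,m)=\sigma(h_1,h_2\triangleright m)*\sigma(h_2,m)$; (vi) $m_1\cdot(m_2\cdot m_3)=(m_1\cdot m_2)\cdot(\gamma(m_1,m_2)\triangleright m_3)$; (vii) $\gamma(m_1,m_2\cdot m_3)*\gamma(m_2,m_3)=\gamma(m_1\cdot m_2,\gamma(m_1,m_2)\triangleright m_3)*\sigma(\gamma(m_1,m_2),m_3)$; (viii) for each $m\in M$ there is $m^r\in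 M$ with $m\cdot m^r=o$. Then (known) $M\bowtie_\gamma H:=M\times H$ is a Lie group with identity $(o,1)$ and product $$(m_1,h_1)(m_2,h_2)=\big(m_1\cdot(h_1\triangleright m_2),\ \gamma(m_1,h_1\triangleright m_2)*\sigma(h_1,m_2)*h_2\big),$$ called the cocycle double cross product. Lie algebra. The Lie algebra of $G=M\bowtie_\gamma H$ is $T_oM\oplus\mathfrak h$ as a vector space, with $\mathfrak h$ a subalgebra; it is denoted $T_oM\bowtie_\theta\mathfrak h$, and its dual is $T_o^*M\oplus\mathfrak h^*$. Define bilinear maps by decomposing brackets into components in $T_oM$ and $\mathfrak h$: $[\eta,v]=\eta\triangleright v+\psi(\eta,v)$ and $[v_1,v_2]=[[v_1,v_2]]+\theta(v_1,v_2)$ for $v,v_1,v_2\in T_oM$, $\eta\in\mathfrak h$. Thus $$[(v_1,\eta_1),(v_2,\eta_2)]=\big([[v_1,v_2]]+\eta_1\triangleright v_2-\eta_2\triangleright v_1,\ [\eta_1,\eta_2]+\psi(\eta_1,v_2)-\psi(\eta_2,v_1)+\theta(v_1,v_2)\big).$$ Maps. $\mathfrak R_m:M\to M$, $n\mapsto n\cdot m$; ${}_m\gamma:M\to H$, $n\mapsto\gamma(n,m)$; ${}_m\varphi:H\to M$, $h\mapsto h\triangleright m$; ${}_m\sigma:H\to H$, $h\mapsto\sigma(h,m)$; $R_h$ is right translation on $H$. For smooth $f$, $Tf$ is the tangent map and $T^*f$ its transpose; all of these are taken at the base points $o\in M$ or $1\in H$. For $S\in\mathfrak h$, $S\triangleright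 m:=T({}_m\varphi)(S)\in T_mM$. For $\alpha\in T_o^*M$: $\langle\alpha\overset{*}{\triangleleft}\eta,w\rangle=\langle\alpha,\eta\triangleright w\rangle$. The linear maps $\mathfrak a_\eta:T_oM\to\mathfrak h$, $v\mapsto\psi(\eta,v)$; $\mathfrak b_v:\mathfrak h\to T_oM$, $\eta\mapsto\eta\triangleright v$; ${}_v\psi:\mathfrak h\to\mathfrak h$, $\eta\mapsto\psi(\eta,v)$; $\theta_v:T_oM\to\mathfrak h$, $w\mapsto\theta(v,w)$ have transposes $\mathfrak a_\eta^*,\mathfrak b_v^*,{}_v\psi^*,\theta_v^*$ (no sign). In contrast $\langle\mathfrak{ad}^*_v\alpha,w\rangle=-\langle\alpha,[[v,w]]\rangle$ and, for any Lie algebra, $\langle\mathrm{ad}^*_\xi\mu,\zeta\rangle=-\langle\mu,[\xi,\zeta]\rangle$. Hamilton's equations. For a Lie group $G$ with Lie algebra $\mathfrak g$, $T^*G$ is identified with $\mathfrak g^*\rtimes G$ by right trivialization, and the (trivialized) Hamilton's equations of $\mathcal H=\mathcal H(\mu,g)$ are $$\frac{d\mu}{dt}=-T^*R_g\Big(\frac{\delta\mathcal H}{\delta g}\Big)+\mathrm{ad}^*_{\frac{\delta\mathcal H}{\delta\mu}}(\mu),\qquad\frac{dg}{dt}=TR_g\Big(\frac{\delta\mathcal H}{\delta\mu}\Big),$$ with partial derivatives $\delta\mathcal H/\delta\mu\in\mathfrak g$, $\delta\mathcal H/\delta g\in T_g^*G$, and $R_g$ right translation. In the claim $\mu=(\kappa,\lambda)\in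 T_o^*M\oplus\mathfrak h^*$, $g=(m,h)$. *)

theory Defs
  imports "HOL-Analysis.Analysis" "HOL-Algebra.Group"
begin

section \<open>Smooth manifolds\<close>

(* C^k for functions on open subsets of finite-dimensional spaces: all iterated directional
   derivatives up to order k exist and are continuous, and those of order < k are Frechet
   differentiable. *)
primrec k_smooth_on ::
  "nat \<Rightarrow> 'a::real_normed_vector set \<Rightarrow> ('a \<Rightarrow> 'b::real_normed_vector) \<Rightarrow> bool" where
  "k_smooth_on 0 S f = continuous_on S f"
| "k_smooth_on (Suc k) S f =
     ((\<forall>x\<in>S. f differentiable (at x)) \<and>
      (\<forall>v. k_smooth_on k S (\<lambda>x. frechet_derivative f (at x) v)))"

definition smooth_on :: "'a::real_normed_vector set \<Rightarrow> ('a \<Rightarrow> 'b::real_normed_vector) \<Rightarrow> bool" where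
  "smooth_on S f \<longleftrightarrow> (\<forall>k. k_smooth_on k S f)"

(* An atlas indexed by the points of the manifold: chart_dom A p and chart A p form a chart
   around p.  Every atlas can be indexed in this way by choosing a chart around each point.
   The points of the manifold are the elements of the type 'm; 'e is the model space.
   It is a finite-dimensional normed space (not of class euclidean_space, so that
   dimension 0 and dual spaces are allowed). *)
record ('m, 'e) charts =
  chart_dom :: "'m \<Rightarrow> 'm set"
  chart :: "'m \<Rightarrow> 'm \<Rightarrow> 'e"

definition chart_inv :: "('m, 'e) charts \<Rightarrow> 'm \<Rightarrow> 'e \<Rightarrow> 'm" where
  "chart_inv A p = inv_into (chart_dom A p) (chart A p)"

definition smooth_manifold ::
  "('m::{t2_space, second_countable_topology}, 'e::real_normed_vector) charts \<Rightarrow> bool" where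
  "smooth_manifold A \<longleftrightarrow>
     (\<exists>B::'e set. finite_dimensional_vector_space (*\<^sub>R) B) \<and>
     (\<forall>p. p \<in> chart_dom A p \<and> open (chart_dom A p) \<and> open (chart A p ` chart_dom A p) \<and>
          homeomorphism (chart_dom A p) (chart A p ` chart_dom A p) (chart A p) (chart_inv A p)) \<and>
     (\<forall>p q. smooth_on (chart A p ` (chart_dom A p \<inter> chart_dom A q)) (chart A q \<circ> chart_inv A p))"

definition smooth_map ::
  "('m::topological_space, 'e::real_normed_vector) charts \<Rightarrow>
   ('n::topological_space, 'f::real_normed_vector) charts \<Rightarrow> ('m \<Rightarrow> 'n) \<Rightarrow> bool" where
  "smooth_map A B f \<longleftrightarrow>
     continuous_on UNIV f \<and>
     (\<forall>p q. smooth_on (chart A p ` (chart_dom A p \<inter> f -` chart_dom B q))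
              (chart B q \<circ> f \<circ> chart_inv A p))"

definition prod_charts ::
  "('m, 'e) charts \<Rightarrow> ('n, 'f) charts \<Rightarrow> ('m \<times> 'n, 'e \<times> 'f) charts"  (infixr \<open>\<times>\<^sub>c\<close> 80) where
  "A \<times>\<^sub>c B = \<lparr> chart_dom = (\<lambda>(p, q). chart_dom A p \<times> chart_dom B q),
              chart = (\<lambda>(p, q) (x, y). (chart A p x, chart B q y)) \<rparr>"

definition flat :: "('v, 'v) charts" where
  "flat = \<lparr> chart_dom = (\<lambda>_. UNIV), chart = (\<lambda>_ x. x) \<rparr>"

(* The tangent space at p is realized as the model space 'e: a tangent vector at p is
   represented by its components in the chart around p that the atlas singles out.  Hence
   the tangent space of a product at (p, q) is the product of the tangent spaces at p and q.
   tangent A B f p is the tangent map from the tangent space at p to that at f p. *)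
definition tangent ::
  "('m, 'e::real_normed_vector) charts \<Rightarrow> ('n, 'f::real_normed_vector) charts \<Rightarrow>
   ('m \<Rightarrow> 'n) \<Rightarrow> 'm \<Rightarrow> 'e \<Rightarrow> 'f" where
  "tangent A B f p = frechet_derivative (chart B (f p) \<circ> f \<circ> chart_inv A p) (at (chart A p p))"

(* c'(t) = v in the tangent space at c t; continuity makes c stay in the chart near t. *)
definition has_velocity ::
  "('m::topological_space, 'e::real_normed_vector) charts \<Rightarrow> (real \<Rightarrow> 'm) \<Rightarrow> real \<Rightarrow> 'e \<Rightarrow> bool" where
  "has_velocity A c t v \<longleftrightarrow>
     isCont c t \<and> ((chart A (c t) \<circ> c) has_vector_derivative v) (at t)"


section \<open>Duality\<close>

(* Dual spaces of finite-dimensional spaces are spaces of bounded linear functionals; a linear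
   map f is automatically bounded, so dual_map f is the transpose of f, without any sign. *)
definition dual_map ::
  "('v::real_normed_vector \<Rightarrow> 'w::real_normed_vector) \<Rightarrow> ('w \<Rightarrow>\<^sub>L real) \<Rightarrow> ('v \<Rightarrow>\<^sub>L real)" where
  "dual_map f \<alpha> = Blinfun (\<lambda>v. blinfun_apply \<alpha> (f v))"

(* The identification of the dual of a direct sum with the direct sum of the duals. *)
definition copair ::
  "('v::real_normed_vector \<Rightarrow>\<^sub>L real) \<Rightarrow> ('w::real_normed_vector \<Rightarrow>\<^sub>L real) \<Rightarrow> (('v \<times> 'w) \<Rightarrow>\<^sub>L real)" where
  "copair \<alpha> \<beta> = Blinfun (\<lambda>(v, w). blinfun_apply \<alpha> v + blinfun_apply \<beta> w)"

definition restr1 :: "(('v::real_normed_vector \<times> 'w::real_normed_vector) \<Rightarrow>\<^sub>L real) \<Rightarrow> ('v \<Rightarrow>\<^sub>L real)" where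
  "restr1 = dual_map (\<lambda>v. (v, 0))"

definition restr2 :: "(('v::real_normed_vector \<times> 'w::real_normed_vector) \<Rightarrow>\<^sub>L real) \<Rightarrow> ('w \<Rightarrow>\<^sub>L real)" where
  "restr2 = dual_map (\<lambda>w. (0, w))"

(* The derivative of a function on the dual space at \<mu>, an element of the bidual, regarded as
   a vector. *)
definition dual_grad :: "(('v::real_normed_vector \<Rightarrow>\<^sub>L real) \<Rightarrow> real) \<Rightarrow> ('v \<Rightarrow>\<^sub>L real) \<Rightarrow> 'v" where
  "dual_grad F \<mu> = (THE \<xi>. (F has_derivative (\<lambda>\<nu>. blinfun_apply \<nu> \<xi>)) (at \<mu>))"

definition differential ::
  "('m, 'e::real_normed_vector) charts \<Rightarrow> ('m \<Rightarrow> real) \<Rightarrow> 'm \<Rightarrow> ('e \<Rightarrow>\<^sub>L real)" where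
  "differential A F p = Blinfun (tangent A flat F p)"


section \<open>Lie groups and Hamilton's equations\<close>

definition lie_group ::
  "('g::{t2_space, second_countable_topology}, 'e::real_normed_vector) charts \<Rightarrow>
   'g monoid \<Rightarrow> bool" where
  "lie_group A G \<longleftrightarrow>
     smooth_manifold A \<and> group G \<and> carrier G = UNIV \<and>
     smooth_map (A \<times>\<^sub>c A) A (\<lambda>(x, y). x \<otimes>\<^bsub>G\<^esub> y) \<and> smooth_map A A (m_inv G)"

(* A vector field X assigns to each p the components of a tangent vector at p (in the chart
   around p).  field_rep A X q is its component function in the chart around q. *)
definition field_rep ::
  "('m, 'e::real_normed_vector) charts \<Rightarrow> ('m \<Rightarrow> 'e) \<Rightarrow> 'm \<Rightarrow> 'e \<Rightarrow> 'e" where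
  "field_rep A X q x =
     tangent A flat (chart A q) (chart_inv A q x) (X (chart_inv A q x))"

(* [X, Y] = DY(X) - DX(Y) in coordinates, i.e. [X, Y] f = X (Y f) - Y (X f). *)
definition field_bracket ::
  "('m, 'e::real_normed_vector) charts \<Rightarrow> ('m \<Rightarrow> 'e) \<Rightarrow> ('m \<Rightarrow> 'e) \<Rightarrow> 'm \<Rightarrow> 'e" where
  "field_bracket A X Y p =
     frechet_derivative (field_rep A Y p) (at (chart A p p)) (X p) -
     frechet_derivative (field_rep A X p) (at (chart A p p)) (Y p)"

definition left_invariant ::
  "('g, 'e::real_normed_vector) charts \<Rightarrow> 'g monoid \<Rightarrow> 'e \<Rightarrow> 'g \<Rightarrow> 'e" where
  "left_invariant A G v g = tangent A A (\<lambda>x. g \<otimes>\<^bsub>G\<^esub> x) \<one>\<^bsub>G\<^esub> v"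

definition lie_bracket ::
  "('g, 'e::real_normed_vector) charts \<Rightarrow> 'g monoid \<Rightarrow> 'e \<Rightarrow> 'e \<Rightarrow> 'e" where
  "lie_bracket A G v w =
     field_bracket A (left_invariant A G v) (left_invariant A G w) \<one>\<^bsub>G\<^esub>"

(* <coad br \<xi> \<mu>, \<zeta>> = - <\<mu>, br \<xi> \<zeta>> for a bilinear map br *)
definition coad ::
  "('v::real_normed_vector \<Rightarrow> 'v \<Rightarrow> 'v) \<Rightarrow> 'v \<Rightarrow> ('v \<Rightarrow>\<^sub>L real) \<Rightarrow> ('v \<Rightarrow>\<^sub>L real)" where
  "coad br \<xi> \<mu> = - dual_map (br \<xi>) \<mu>"

definition hamilton_solution ::
  "('g::topological_space, 'e::real_normed_vector) charts \<Rightarrow> 'g monoid \<Rightarrow>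
   (('e \<Rightarrow>\<^sub>L real) \<Rightarrow> 'g \<Rightarrow> real) \<Rightarrow> real set \<Rightarrow> (real \<Rightarrow> ('e \<Rightarrow>\<^sub>L real)) \<Rightarrow> (real \<Rightarrow> 'g) \<Rightarrow> bool" where
  "hamilton_solution A G \<H> I \<mu> g \<longleftrightarrow>
     (\<forall>t\<in>I.
        let d\<mu> = dual_grad (\<lambda>\<nu>. \<H> \<nu> (g t)) (\<mu> t);
            dg = differential A (\<H> (\<mu> t)) (g t);
            TR = tangent A A (\<lambda>x. x \<otimes>\<^bsub>G\<^esub> g t) \<one>\<^bsub>G\<^esub>
        in (\<mu> has_vector_derivative (- dual_map TR dg + coad (lie_bracket A G) d\<mu> (\<mu> t))) (at t) \<and>
           has_velocity A g t (TR d\<mu>))"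


section \<open>Cocycle matched pairs\<close>

record ('m, 'e, 'h, 'f) matched_pair =
  Mchts :: "('m, 'e) charts"
  pt :: 'm
  Hchts :: "('h, 'f) charts"
  Hgrp :: "'h monoid"
  act :: "'h \<Rightarrow> 'm \<Rightarrow> 'm"  (infixr \<open>\<triangleright>\<index>\<close> 75)
  dot :: "'m \<Rightarrow> 'm \<Rightarrow> 'm"  (infixl \<open>\<cdot>\<index>\<close> 72)
  sig :: "'h \<Rightarrow> 'm \<Rightarrow> 'h"
  gam :: "'m \<Rightarrow> 'm \<Rightarrow> 'h"

abbreviation hmult :: "('m, 'e, 'h, 'f) matched_pair \<Rightarrow> 'h \<Rightarrow> 'h \<Rightarrow> 'h"
  (infixl \<open>\<star>\<index>\<close> 70) where
  "h1 \<star>\<^bsub>P\<^esub> h2 \<equiv> h1 \<otimes>\<^bsub>Hgrp P\<^esub> h2"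

abbreviation hone :: "('m, 'e, 'h, 'f) matched_pair \<Rightarrow> 'h" where
  "hone P \<equiv> \<one>\<^bsub>Hgrp P\<^esub>"

locale cocycle_matched_pair =
  fixes P :: "('m::{t2_space, second_countable_topology}, 'e::real_normed_vector,
               'h::{t2_space, second_countable_topology}, 'f::real_normed_vector) matched_pair"
    (structure)
  assumes manifold: "smooth_manifold (Mchts P)"
    and lie_group: "lie_group (Hchts P) (Hgrp P)"
    and smooth_act: "smooth_map (Hchts P \<times>\<^sub>c Mchts P) (Mchts P) (\<lambda>(h, m). h \<triangleright> m)"
    and smooth_sig: "smooth_map (Hchts P \<times>\<^sub>c Mchts P) (Hchts P) (\<lambda>(h, m). sig P h m)"
    and smooth_dot: "smooth_map (Mchts P \<times>\<^sub>c Mchts P) (Mchts P) (\<lambda>(m1, m2). m1 \<cdot> m2)"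
    and smooth_gam: "smooth_map (Mchts P \<times>\<^sub>c Mchts P) (Hchts P) (\<lambda>(m1, m2). gam P m1 m2)"
    and act_one: "hone P \<triangleright> m = m"
    and act_mult: "(h1 \<star> h2) \<triangleright> m = h1 \<triangleright> (h2 \<triangleright> m)"
    and act_pt: "h \<triangleright> pt P = pt P"
    and sig_pt: "sig P h (pt P) = h"
    and sig_one: "sig P (hone P) m = hone P"
    and gam_pt_pt: "gam P (pt P) (pt P) = hone P"
    and pt_dot: "pt P \<cdot> m = m"
    and dot_pt: "m \<cdot> pt P = m"
    and gam_pt: "gam P m (pt P) = hone P"
    and pt_gam: "gam P (pt P) m = hone P"
    and act_dot: "h \<triangleright> (m1 \<cdot> m2) = (h \<triangleright> m1) \<cdot> (sig P h m1 \<triangleright> m2)"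
    and sig_dot: "sig P h (m1 \<cdot> m2) \<star> gam P m1 m2 =
                  gam P (h \<triangleright> m1) (sig P h m1 \<triangleright> m2) \<star> sig P (sig P h m1) m2"
    and sig_mult: "sig P (h1 \<star> h2) m = sig P h1 (h2 \<triangleright> m) \<star> sig P h2 m"
    and dot_assoc: "m1 \<cdot> (m2 \<cdot> m3) = (m1 \<cdot> m2) \<cdot> (gam P m1 m2 \<triangleright> m3)"
    and gam_cocycle: "gam P m1 (m2 \<cdot> m3) \<star> gam P m2 m3 =
                  gam P (m1 \<cdot> m2) (gam P m1 m2 \<triangleright> m3) \<star> sig P (gam P m1 m2) m3"
    and right_inverse: "\<exists>r. m \<cdot> r = pt P"

definition dcp_charts :: "('m, 'e, 'h, 'f) matched_pair \<Rightarrow> ('m \<times> 'h, 'e \<times> 'f) charts" where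
  "dcp_charts P = Mchts P \<times>\<^sub>c Hchts P"

definition dcp :: "('m, 'e, 'h, 'f) matched_pair \<Rightarrow> ('m \<times> 'h) monoid" where
  "dcp P = \<lparr> carrier = UNIV,
     mult = (\<lambda>(m1, h1) (m2, h2).
       (m1 \<cdot>\<^bsub>P\<^esub> (h1 \<triangleright>\<^bsub>P\<^esub> m2),
        (gam P m1 (h1 \<triangleright>\<^bsub>P\<^esub> m2) \<star>\<^bsub>P\<^esub> sig P h1 m2) \<star>\<^bsub>P\<^esub> h2)),
     one = (pt P, hone P) \<rparr>"

definition dcp_bracket ::
  "('m, 'e::real_normed_vector, 'h, 'f::real_normed_vector) matched_pair \<Rightarrow>
   'e \<times> 'f \<Rightarrow> 'e \<times> 'f \<Rightarrow> 'e \<times> 'f" where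
  "dcp_bracket P = lie_bracket (dcp_charts P) (dcp P)"

abbreviation h_bracket ::
  "('m, 'e, 'h, 'f::real_normed_vector) matched_pair \<Rightarrow> 'f \<Rightarrow> 'f \<Rightarrow> 'f" where
  "h_bracket P \<equiv> lie_bracket (Hchts P) (Hgrp P)"

(* Components of [\<eta>, v] and [v, w] in the Lie algebra of the double cross product. *)

definition inf_act ::
  "('m, 'e::real_normed_vector, 'h, 'f::real_normed_vector) matched_pair \<Rightarrow> 'f \<Rightarrow> 'e \<Rightarrow> 'e" where
  "inf_act P \<eta> v = fst (dcp_bracket P (0, \<eta>) (v, 0))"

definition psi ::
  "('m, 'e::real_normed_vector, 'h, 'f::real_normed_vector) matched_pair \<Rightarrow> 'f \<Rightarrow> 'e \<Rightarrow> 'f" where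
  "psi P \<eta> v = snd (dcp_bracket P (0, \<eta>) (v, 0))"

definition v_bracket ::
  "('m, 'e::real_normed_vector, 'h, 'f::real_normed_vector) matched_pair \<Rightarrow> 'e \<Rightarrow> 'e \<Rightarrow> 'e" where
  "v_bracket P v w = fst (dcp_bracket P (v, 0) (w, 0))"

definition theta ::
  "('m, 'e::real_normed_vector, 'h, 'f::real_normed_vector) matched_pair \<Rightarrow> 'e \<Rightarrow> 'e \<Rightarrow> 'f" where
  "theta P v w = snd (dcp_bracket P (v, 0) (w, 0))"

definition dual_act ::
  "('m, 'e::real_normed_vector, 'h, 'f::real_normed_vector) matched_pair \<Rightarrow>
   ('e \<Rightarrow>\<^sub>L real) \<Rightarrow> 'f \<Rightarrow> ('e \<Rightarrow>\<^sub>L real)" where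
  "dual_act P \<alpha> \<eta> = dual_map (inf_act P \<eta>) \<alpha>"

(* Infinitesimal action S \<triangleright> m on the points of M, an element of the tangent space at m. *)
definition inf_act_pt ::
  "('m, 'e::real_normed_vector, 'h, 'f::real_normed_vector) matched_pair \<Rightarrow> 'f \<Rightarrow> 'm \<Rightarrow> 'e" where
  "inf_act_pt P S m = tangent (Hchts P) (Mchts P) (\<lambda>h. h \<triangleright>\<^bsub>P\<^esub> m) (hone P) S"

end

theory Submission
  imports Defs
begin

text \<open>
  In right trivialization, Hamilton's equations of a Lie group G are determined by three linear
  objects: the tangent map of the right translation by g at the identity, its transpose, and the
  coadjoint action of the Lie algebra.  For the double cross product all three split along the
  decomposition of the Lie algebra into the tangent space of M at the base point and the Lie
  algebra of H, and the four equations are the components of the two equations of G.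

  The translation.  The points (n, 1) and (o, k) satisfy
  (n, 1)(m, h) = (n \<cdot> m, \<gamma>(n, m) * h) and (o, k)(m, h) = (k \<triangleright> m, \<sigma>(k, m) * h), so that the four blocks of
  the tangent map are partial derivatives (\<open>tangent_right_translation\<close>).  They give the equations
  for m and h, and by transposition the terms with the derivatives of the Hamiltonian along M
  and H (\<open>restr_force\<close>).

  The bracket.  It is bilinear and antisymmetric, and on the Lie algebra of H it is the
  bracket of H (\<open>dcp_bracket_H\<close>); the remaining components are the infinitesimal action, \<psi>, the
  bracket on the tangent space of M and \<theta>.  Hence the formula \<open>dcp_bracket_decomposition\<close>, and by
  pairing with (\<kappa>, \<lambda>) the coadjoint terms (\<open>restr_coad\<close>).  The reason for bilinearity is that the
  component function of a left-invariant field in the chart at the identity is a partial derivative of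
  the multiplication in coordinates, hence linear in the generating vector and again
  differentiable (\<open>field_rep_left_invariant\<close>).

  The derivatives of the Hamiltonian.  Since the dual of a direct sum is the direct sum of the
  duals, the derivatives of the Hamiltonian along the dual of the Lie algebra and along the group are
  pairs of partial derivatives (\<open>dual_grad_direct_sum\<close>, \<open>differential_prod\<close>).  A derivative
  along a dual space is a vector because finite-dimensional spaces are reflexive; all linear maps
  have transposes because linear maps on such spaces are bounded.  Both facts come from the
  boundedness of the coordinate functionals (\<open>fin_dim_coordinates\<close>), which also yields the chain rule for
  functions of class C^k (\<open>k_smooth_on_compose\<close>) and with it the smoothness of the multiplication.
\<close>

section \<open>Finite-dimensional normed spaces\<close>

text \<open>
  A predicate on types, so that one formulation covers model spaces, products and dual spaces,
  including those of dimension 0.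
\<close>
definition fin_dim :: "'a::real_normed_vector itself \<Rightarrow> bool" where
  "fin_dim _ \<longleftrightarrow> (\<exists>B::'a set. finite B \<and> span B = UNIV)"

text \<open>
  All norms on the space of coefficients are equivalent: by Tychonoff's theorem the coefficient vectors of
  l1-norm 1 form a compact set, on which the norm of the combination has a minimum, and
  independence makes this minimum positive.
\<close>
lemma independent_coefficient_bound:
  fixes B :: "'a::real_normed_vector set"
  assumes fin: "finite B" and ind: "independent B"
  obtains d where "d > 0"
    "\<And>a. d * (\<Sum>b\<in>B. \<bar>a b\<bar>) \<le> norm (\<Sum>b\<in>B. a b *\<^sub>R b)"
proof -
  define N :: "('a \<Rightarrow> real) \<Rightarrow> real" where "N a = (\<Sum>b\<in>B. \<bar>a b\<bar>)" for a
  define F :: "('a \<Rightarrow> real) \<Rightarrow> real" where "F a = norm (\<Sum>b\<in>B. a b *\<^sub>R b)" for a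
  \<comment> \<open>Coefficients outside B are set to 0, so that K is a product of compact sets over all of the type.\<close>
  define K where "K = PiE UNIV (\<lambda>b. if b \<in> B then {-1..1::real} else {0})"
  define S where "S = K \<inter> {a. N a = 1}"
  have "compactin (product_topology (\<lambda>_. euclidean) UNIV) K"
    unfolding K_def compactin_PiE by auto
  then have "compact K"
    by (simp add: euclidean_product_topology)
  moreover have "closed {a. N a = 1}"
    unfolding N_def
    by (intro closed_Collect_eq continuous_intros) auto
  ultimately have "compact S"
    unfolding S_def by blast
  have contF: "continuous_on S F"
    unfolding F_def by (intro continuous_intros continuous_on_subset[OF continuous_on_product_coordinates]) auto
  obtain d where d: "d > 0" "\<And>a. a \<in> S \<Longrightarrow> d \<le> F a"
  proof (cases "S = {}")
    case True
    then show ?thesis using that[of 1] by auto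
  next
    case False
    from continuous_attains_inf[OF \<open>compact S\<close> this contF]
    obtain a where a: "a \<in> S" "\<And>b. b \<in> S \<Longrightarrow> F a \<le> F b" by auto
    have "F a \<noteq> 0"
    proof
      assume "F a = 0"
      then have "(\<Sum>b\<in>B. a b *\<^sub>R b) = 0" by (simp add: F_def)
      then have "\<forall>b\<in>B. a b = 0"
        using independentD[OF ind fin order_refl] by blast
      then have "N a = 0" by (simp add: N_def)
      with a(1) show False by (simp add: S_def)
    qed
    then have "F a > 0" by (simp add: F_def)
    with a(2) show ?thesis using that by blast
  qed
  show thesis
  proof (rule that[OF d(1)])
    fix a :: "'a \<Rightarrow> real"
    show "d * (\<Sum>b\<in>B. \<bar>a b\<bar>) \<le> norm (\<Sum>b\<in>B. a b *\<^sub>R b)"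
    proof (cases "N a = 0")
      case True
      then show ?thesis by (simp add: N_def)
    next
      case False
      have "N a \<ge> 0" by (simp add: N_def sum_nonneg)
      with False have pos: "N a > 0" by simp
      define a' where "a' b = (if b \<in> B then a b / N a else 0)" for b
      have "\<bar>a b\<bar> \<le> N a" if "b \<in> B" for b
        unfolding N_def using fin that by (intro member_le_sum) auto
      then have "\<bar>a b / N a\<bar> \<le> 1" if "b \<in> B" for b
        using that pos by simp
      then have "-1 \<le> a b / N a \<and> a b / N a \<le> 1" if "b \<in> B" for b
        using that by (smt (verit))
      then have "a' \<in> K" by (auto simp: K_def a'_def)
      moreover have "N a' = (\<Sum>b\<in>B. \<bar>a b\<bar> / N a)"
        unfolding N_def[of a'] a'_def using pos by (intro sum.cong) auto
      then have "N a' = 1"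
        using pos by (simp add: sum_divide_distrib[symmetric] N_def[symmetric])
      ultimately have "d \<le> F a'" using d(2) by (simp add: S_def)
      moreover have "(\<Sum>b\<in>B. a' b *\<^sub>R b) = (1 / N a) *\<^sub>R (\<Sum>b\<in>B. a b *\<^sub>R b)"
        unfolding scaleR_sum_right a'_def by (intro sum.cong) (auto simp: divide_inverse mult.commute)
      then have "F a' = F a / N a"
        using pos by (simp add: F_def)
      ultimately show ?thesis
        using pos by (simp add: F_def N_def pos_le_divide_eq)
    qed
  qed
qed

text \<open>
  The form in which finite dimension is used: every vector is a finite combination whose
  coefficients are continuous linear functionals of it.
\<close>
lemma fin_dim_coordinates:
  assumes "fin_dim TYPE('a::real_normed_vector)"
  obtains B :: "'a::real_normed_vector set" and c :: "'a::real_normed_vector \<Rightarrow> 'a \<Rightarrow> real"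
  where "finite B" "\<And>b. b \<in> B \<Longrightarrow> bounded_linear (c b)" "\<And>x. (\<Sum>b\<in>B. c b x *\<^sub>R b) = x"
proof -
  obtain B0 :: "'a set" where B0: "finite B0" "span B0 = UNIV"
    using assms by (auto simp: fin_dim_def)
  obtain B where B: "B \<subseteq> B0" "independent B" "B0 \<subseteq> span B"
    using maximal_independent_subset[of B0] by blast
  have fin: "finite B" using B(1) B0(1) finite_subset by blast
  have sp: "span B = UNIV" using B(3) B0(2) by (metis span_mono span_span top.extremum_uniqueI)
  obtain d where d: "d > 0" "\<And>a. d * (\<Sum>b\<in>B. \<bar>a b\<bar>) \<le> norm (\<Sum>b\<in>B. a b *\<^sub>R b)"
    using independent_coefficient_bound[OF fin B(2)] by blast
  define c where "c b x = representation B x b" for b x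
  have ex: "(\<Sum>b\<in>B. c b x *\<^sub>R b) = x" for x
    unfolding c_def using sum_representation_eq[OF B(2) _ fin order_refl, of x] sp by auto
  have "bounded_linear (c b)" if "b \<in> B" for b
  proof (rule bounded_linear_intro)
    show "c b (x + y) = c b x + c b y" for x y
      unfolding c_def using representation_add[OF B(2)] sp by auto
    show "c b (r *\<^sub>R x) = r *\<^sub>R c b x" for r x
      unfolding c_def using representation_scale[OF B(2)] sp by auto
    show "norm (c b x) \<le> norm x * (1 / d)" for x
    proof -
      have "\<bar>c b x\<bar> \<le> (\<Sum>b\<in>B. \<bar>c b x\<bar>)"
        using fin that by (intro member_le_sum) auto
      then have "d * \<bar>c b x\<bar> \<le> d * (\<Sum>b\<in>B. \<bar>c b x\<bar>)" using d(1) by simp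
      also have "\<dots> \<le> norm x" using d(2)[of "\<lambda>b. c b x"] by (simp add: ex)
      finally show ?thesis using d(1) by (simp add: field_simps)
    qed
  qed
  with that fin ex show thesis by blast
qed

lemma linear_imp_bounded_linear:
  fixes f :: "'a::real_normed_vector \<Rightarrow> 'b::real_normed_vector"
  assumes "fin_dim TYPE('a)" and f: "linear f"
  shows "bounded_linear f"
proof -
  obtain B :: "'a set" and c where Bc: "finite B" "\<And>b. b \<in> B \<Longrightarrow> bounded_linear (c b)"
      "\<And>x. (\<Sum>b\<in>B. c b x *\<^sub>R b) = x"
    using fin_dim_coordinates[OF assms(1)] by blast
  have "f x = (\<Sum>b\<in>B. c b x *\<^sub>R f b)" for x
    by (subst Bc(3)[of x, symmetric]) (simp add: linear_sum[OF f] linear_cmul[OF f])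
  then have "f = (\<lambda>x. \<Sum>b\<in>B. c b x *\<^sub>R f b)" by blast
  moreover have "bounded_linear (\<lambda>x. \<Sum>b\<in>B. c b x *\<^sub>R f b)"
    using Bc(2) by (intro bounded_linear_sum bounded_linear_scaleR_const) auto
  ultimately show ?thesis by simp
qed

lemma fin_dim_prod:
  assumes "fin_dim TYPE('a::real_normed_vector)" "fin_dim TYPE('b::real_normed_vector)"
  shows "fin_dim TYPE('a \<times> 'b)"
proof -
  obtain B :: "'a set" and C :: "'b set"
    where B: "finite B" "span B = UNIV" and C: "finite C" "span C = UNIV"
    using assms by (auto simp: fin_dim_def)
  let ?E = "(\<lambda>b. (b, 0)) ` B \<union> (\<lambda>c. (0, c)) ` C"
  have "linear (\<lambda>b::'a. (b, 0::'b))" "linear (\<lambda>c::'b. (0::'a, c))"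
    by (auto intro!: linearI)
  then have "(v, 0) \<in> span ?E" "(0, w) \<in> span ?E" for v w
    using linear_span_image[of "\<lambda>b::'a. (b, 0::'b)" B] linear_span_image[of "\<lambda>c::'b. (0::'a, c)" C] B C
      span_mono[of "(\<lambda>b. (b, 0)) ` B" ?E] span_mono[of "(\<lambda>c. (0, c)) ` C" ?E]
    by auto
  then have "(v, 0) + (0, w) \<in> span ?E" for v w by (intro span_add)
  then have "span ?E = UNIV" by auto
  then show ?thesis
    unfolding fin_dim_def using B C by (intro exI[of _ ?E]) auto
qed

lemma dual_expansion:
  fixes \<nu> :: "'a::real_normed_vector \<Rightarrow>\<^sub>L real"
  assumes "\<And>b. b \<in> B \<Longrightarrow> bounded_linear (c b)" "\<And>x. (\<Sum>b\<in>B. c b x *\<^sub>R b) = x"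
  shows "\<nu> = (\<Sum>b\<in>B. blinfun_apply \<nu> b *\<^sub>R Blinfun (c b))"
proof (rule blinfun_eqI)
  fix x
  have "blinfun_apply \<nu> x = (\<Sum>b\<in>B. c b x * blinfun_apply \<nu> b)"
    by (subst assms(2)[of x, symmetric]) (simp add: blinfun.sum_right blinfun.scaleR_right)
  also have "\<dots> = blinfun_apply (\<Sum>b\<in>B. blinfun_apply \<nu> b *\<^sub>R Blinfun (c b)) x"
    by (simp add: blinfun.sum_left blinfun.scaleR_left bounded_linear_Blinfun_apply assms(1) mult.commute)
  finally show "blinfun_apply \<nu> x = blinfun_apply (\<Sum>b\<in>B. blinfun_apply \<nu> b *\<^sub>R Blinfun (c b)) x" .
qed

lemma fin_dim_dual:
  assumes "fin_dim TYPE('a::real_normed_vector)"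
  shows "fin_dim TYPE('a \<Rightarrow>\<^sub>L real)"
proof -
  obtain B :: "'a set" and c where Bc: "finite B" "\<And>b. b \<in> B \<Longrightarrow> bounded_linear (c b)"
      "\<And>x. (\<Sum>b\<in>B. c b x *\<^sub>R b) = x"
    using fin_dim_coordinates[OF assms] by blast
  have "\<nu> \<in> span ((\<lambda>b. Blinfun (c b)) ` B)" for \<nu> :: "'a \<Rightarrow>\<^sub>L real"
  proof (subst dual_expansion[OF Bc(2,3), of \<nu>])
    show "(\<Sum>b\<in>B. blinfun_apply \<nu> b *\<^sub>R Blinfun (c b)) \<in> span ((\<lambda>b. Blinfun (c b)) ` B)"
      by (intro span_sum span_scale span_base) auto
  qed auto
  then show ?thesis
    unfolding fin_dim_def using Bc(1) by (intro exI[of _ "(\<lambda>b. Blinfun (c b)) ` B"]) auto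
qed

lemma dual_separates_points:
  fixes x y :: "'a::real_normed_vector"
  assumes "fin_dim TYPE('a)" and eq: "\<And>\<nu>::'a \<Rightarrow>\<^sub>L real. blinfun_apply \<nu> x = blinfun_apply \<nu> y"
  shows "x = y"
proof -
  obtain B :: "'a set" and c where Bc: "finite B" "\<And>b. b \<in> B \<Longrightarrow> bounded_linear (c b)"
      "\<And>x. (\<Sum>b\<in>B. c b x *\<^sub>R b) = x"
    using fin_dim_coordinates[OF assms(1)] by blast
  have "c b x = c b y" if "b \<in> B" for b
    using eq[of "Blinfun (c b)"] by (simp add: bounded_linear_Blinfun_apply Bc(2) that)
  then have "(\<Sum>b\<in>B. c b x *\<^sub>R b) = (\<Sum>b\<in>B. c b y *\<^sub>R b)" by simp
  then show ?thesis by (simp only: Bc(3))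
qed

text \<open>
  Reflexivity: the representing vector has the values of L on the coordinate functionals as
  its coordinates.
\<close>
lemma bidual_evaluation:
  fixes L :: "('a::real_normed_vector \<Rightarrow>\<^sub>L real) \<Rightarrow> real"
  assumes "fin_dim TYPE('a)" and L: "linear L"
  obtains \<xi> where "L = (\<lambda>\<nu>. blinfun_apply \<nu> \<xi>)"
proof -
  obtain B :: "'a set" and c where Bc: "finite B" "\<And>b. b \<in> B \<Longrightarrow> bounded_linear (c b)"
      "\<And>x. (\<Sum>b\<in>B. c b x *\<^sub>R b) = x"
    using fin_dim_coordinates[OF assms(1)] by blast
  have "L \<nu> = blinfun_apply \<nu> (\<Sum>b\<in>B. L (Blinfun (c b)) *\<^sub>R b)" for \<nu>
    by (subst dual_expansion[OF Bc(2,3), of \<nu>])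
      (simp_all add: linear_sum[OF L] linear_cmul[OF L] blinfun.sum_right blinfun.scaleR_right mult.commute)
  then show thesis using that by blast
qed

section \<open>Functions of class C^k\<close>
lemma has_frechet_derivative:
  "f differentiable (at x) \<Longrightarrow> (f has_derivative frechet_derivative f (at x)) (at x)"
  by (simp add: frechet_derivative_works)

lemma frechet_derivative_eqI: "(f has_derivative f') (at x) \<Longrightarrow> frechet_derivative f (at x) = f'"
  by (rule frechet_derivative_at[symmetric])

lemma has_derivative_cong_open:
  assumes "open S" "x \<in> S" "\<And>y. y \<in> S \<Longrightarrow> f y = g y"
  shows "(f has_derivative f') (at x) \<longleftrightarrow> (g has_derivative f') (at x)"
  using assms by (metis has_derivative_transform_within_open)

lemma frechet_derivative_cong_open:
  assumes "open S" "x \<in> S" "\<And>y. y \<in> S \<Longrightarrow> f y = g y"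
  shows "frechet_derivative f (at x) = frechet_derivative g (at x)"
  unfolding frechet_derivative_def using has_derivative_cong_open[OF assms] by simp

lemma k_smooth_on_cong:
  assumes "open S" "\<And>x. x \<in> S \<Longrightarrow> f x = g x" "k_smooth_on k S f"
  shows "k_smooth_on k S g"
  using assms(2,3)
proof (induction k arbitrary: f g)
  case 0
  then show ?case by (metis continuous_on_cong k_smooth_on.simps(1))
next
  case (Suc k)
  have "g differentiable (at x)" if "x \<in> S" for x
  proof -
    from Suc.prems(2) that have "(f has_derivative frechet_derivative f (at x)) (at x)"
      by (simp add: frechet_derivative_works)
    then have "(g has_derivative frechet_derivative f (at x)) (at x)"
      using has_derivative_cong_open[OF assms(1) that, of f g] Suc.prems(1) by blast
    then show ?thesis by (auto simp: differentiable_def)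
  qed
  moreover have "k_smooth_on k S (\<lambda>x. frechet_derivative g (at x) v)" for v
  proof (rule Suc.IH)
    show "k_smooth_on k S (\<lambda>x. frechet_derivative f (at x) v)" using Suc.prems by simp
    show "frechet_derivative f (at x) v = frechet_derivative g (at x) v" if "x \<in> S" for x
      using frechet_derivative_cong_open[OF assms(1) that, of f g] Suc.prems by simp
  qed
  ultimately show ?case by simp
qed

lemma k_smooth_on_subset: "k_smooth_on k S f \<Longrightarrow> T \<subseteq> S \<Longrightarrow> k_smooth_on k T f"
  by (induction k arbitrary: f) (auto intro: continuous_on_subset)

lemma k_smooth_on_imp_continuous_on: "k_smooth_on k S f \<Longrightarrow> continuous_on S f"
  by (cases k)
    (auto intro!: continuous_at_imp_continuous_on differentiable_imp_continuous_within)

lemma k_smooth_on_SucD: "k_smooth_on (Suc k) S f \<Longrightarrow> k_smooth_on k S f"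
proof (induction k arbitrary: f)
  case 0
  then show ?case using k_smooth_on_imp_continuous_on by fastforce
next
  case (Suc k)
  have "k_smooth_on k S (\<lambda>x. frechet_derivative f (at x) v)" for v
    by (rule Suc.IH) (use Suc.prems in simp)
  with Suc.prems show ?case by (auto simp: k_smooth_on.simps(2) simp del: k_smooth_on.simps(1))
qed

lemma k_smooth_on_const: "k_smooth_on k S (\<lambda>x. c)"
  by (induction k arbitrary: c) (auto intro: continuous_intros)

lemma k_smooth_on_bounded_linear_compose:
  assumes L: "bounded_linear L" and "k_smooth_on k S f" "open S"
  shows "k_smooth_on k S (\<lambda>x. L (f x))"
  using assms(2)
proof (induction k arbitrary: f)
  case 0
  then show ?case using bounded_linear.continuous_on[OF L] by auto
next
  case (Suc k)
  have d: "((\<lambda>x. L (f x)) has_derivative (\<lambda>v. L (frechet_derivative f (at x) v))) (at x)"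
    if "x \<in> S" for x
    using Suc.prems that
    by (intro bounded_linear.has_derivative[OF L] has_frechet_derivative) auto
  have "k_smooth_on k S (\<lambda>x. frechet_derivative (\<lambda>x. L (f x)) (at x) v)" for v
    by (rule k_smooth_on_cong[OF assms(3) _ Suc.IH])
      (use Suc.prems frechet_derivative_eqI[OF d] in auto)
  with d show ?case by (auto simp: differentiable_def)
qed

lemma k_smooth_on_add:
  assumes "open S"
  shows "k_smooth_on k S f \<Longrightarrow> k_smooth_on k S g \<Longrightarrow> k_smooth_on k S (\<lambda>x. f x + g x)"
proof (induction k arbitrary: f g)
  case 0
  then show ?case by (auto intro: continuous_intros)
next
  case (Suc k)
  have d: "((\<lambda>x. f x + g x) has_derivative
      (\<lambda>v. frechet_derivative f (at x) v + frechet_derivative g (at x) v)) (at x)"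
    if "x \<in> S" for x
    using Suc.prems that by (intro has_derivative_add has_frechet_derivative) auto
  have "k_smooth_on k S (\<lambda>x. frechet_derivative (\<lambda>x. f x + g x) (at x) v)" for v
    by (rule k_smooth_on_cong[OF assms _ Suc.IH[of "\<lambda>x. frechet_derivative f (at x) v" "\<lambda>x. frechet_derivative g (at x) v"]])
      (use Suc.prems frechet_derivative_eqI[OF d] in auto)
  with d show ?case by (auto simp: differentiable_def)
qed

lemma k_smooth_on_sum:
  assumes "open S" "finite B" "\<And>b. b \<in> B \<Longrightarrow> k_smooth_on k S (f b)"
  shows "k_smooth_on k S (\<lambda>x. \<Sum>b\<in>B. f b x)"
  using assms(2,3)
proof (induction B rule: finite_induct)
  case empty
  then show ?case by (simp add: k_smooth_on_const)
next
  case (insert b B)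
  then show ?case using k_smooth_on_add[OF assms(1), of k "f b" "\<lambda>x. \<Sum>b\<in>B. f b x"] by simp
qed

lemma k_smooth_on_scaleR:
  assumes "open S"
  shows "k_smooth_on k S f \<Longrightarrow> k_smooth_on k S g \<Longrightarrow> k_smooth_on k S (\<lambda>x. f x *\<^sub>R g x)"
proof (induction k arbitrary: f g)
  case 0
  then show ?case by (auto intro: continuous_intros)
next
  case (Suc k)
  have d: "((\<lambda>x. f x *\<^sub>R g x) has_derivative
      (\<lambda>v. f x *\<^sub>R frechet_derivative g (at x) v + frechet_derivative f (at x) v *\<^sub>R g x)) (at x)"
    if "x \<in> S" for x
    using Suc.prems that by (intro has_derivative_scaleR has_frechet_derivative) auto
  have "k_smooth_on k S (\<lambda>x. frechet_derivative (\<lambda>x. f x *\<^sub>R g x) (at x) v)" for v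
    by (rule k_smooth_on_cong[OF assms _
          k_smooth_on_add[OF assms Suc.IH[of f "\<lambda>x. frechet_derivative g (at x) v"]
            Suc.IH[of "\<lambda>x. frechet_derivative f (at x) v" g]]])
      (use Suc.prems Suc.prems[THEN k_smooth_on_SucD] frechet_derivative_eqI[OF d] in auto)
  with d show ?case by (auto simp: differentiable_def)
qed

text \<open>
  The derivative of a composition in direction v is Dg(f x)(Df(x) v).  Its vector argument depends
  on x, whereas the definition of class C^k speaks of fixed directions; expanding Df(x) v in
  coordinates turns it into a finite sum of products to which the induction hypothesis applies.
\<close>
lemma k_smooth_on_compose:
  fixes f :: "'a::real_normed_vector \<Rightarrow> 'b::real_normed_vector"
    and g :: "'b \<Rightarrow> 'c::real_normed_vector"
  assumes fd: "fin_dim TYPE('b)" and S: "open S" and T: "f ` S \<subseteq> T"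
  shows "k_smooth_on k S f \<Longrightarrow> k_smooth_on k T g \<Longrightarrow> k_smooth_on k S (\<lambda>x. g (f x))"
proof (induction k arbitrary: g)
  case 0
  then show ?case using T by (auto intro: continuous_on_compose2)
next
  case (Suc k)
  obtain B :: "'b set" and c where Bc: "finite B" "\<And>b. b \<in> B \<Longrightarrow> bounded_linear (c b)"
      "\<And>x. (\<Sum>b\<in>B. c b x *\<^sub>R b) = x"
    using fin_dim_coordinates[OF fd] by blast
  have d: "((\<lambda>x. g (f x)) has_derivative
      (\<lambda>v. frechet_derivative g (at (f x)) (frechet_derivative f (at x) v))) (at x)"
    if "x \<in> S" for x
    by (rule has_derivative_compose[OF has_frechet_derivative has_frechet_derivative])
      (use Suc.prems that T in auto)
  have expand: "(\<Sum>b\<in>B. c b (frechet_derivative f (at x) v) *\<^sub>R frechet_derivative g (at (f x)) b)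
      = frechet_derivative (\<lambda>x. g (f x)) (at x) v" if x: "x \<in> S" for x v
  proof -
    have lin: "linear (frechet_derivative g (at (f x)))"
      using Suc.prems x T by (intro linear_frechet_derivative) auto
    show ?thesis
      unfolding frechet_derivative_eqI[OF d[OF x]]
      by (subst (2) Bc(3)[symmetric, of "frechet_derivative f (at x) v"])
        (simp add: linear_sum[OF lin] linear_cmul[OF lin])
  qed
  have "k_smooth_on k S (\<lambda>x. frechet_derivative (\<lambda>x. g (f x)) (at x) v)" for v
  proof (rule k_smooth_on_cong[OF S expand])
    show "k_smooth_on k S
      (\<lambda>x. \<Sum>b\<in>B. c b (frechet_derivative f (at x) v) *\<^sub>R frechet_derivative g (at (f x)) b)"
    proof (rule k_smooth_on_sum[OF S Bc(1)], rule k_smooth_on_scaleR[OF S])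
      fix b assume b: "b \<in> B"
      show "k_smooth_on k S (\<lambda>x. c b (frechet_derivative f (at x) v))"
        by (rule k_smooth_on_bounded_linear_compose[OF Bc(2)[OF b] _ S]) (use Suc.prems in simp)
      show "k_smooth_on k S (\<lambda>x. frechet_derivative g (at (f x)) b)"
        by (rule Suc.IH[OF k_smooth_on_SucD[OF Suc.prems(1)]]) (use Suc.prems in simp)
    qed
  qed
  with d show ?case by (auto simp: differentiable_def)
qed

lemma k_smooth_on_Pair:
  assumes "open S"
  shows "k_smooth_on k S f \<Longrightarrow> k_smooth_on k S g \<Longrightarrow> k_smooth_on k S (\<lambda>x. (f x, g x))"
  using k_smooth_on_add[OF assms, of k "\<lambda>x. (f x, 0)" "\<lambda>x. (0, g x)"]
    k_smooth_on_bounded_linear_compose[of "\<lambda>y. (y, 0)", OF _ _ assms, of k f]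
    k_smooth_on_bounded_linear_compose[of "\<lambda>y. (0, y)", OF _ _ assms, of k g]
  by (auto simp: bounded_linear_Pair bounded_linear_ident bounded_linear_zero)

lemma k_smooth_on_id: "open S \<Longrightarrow> k_smooth_on k S (\<lambda>x. x)"
  by (cases k) (auto simp: k_smooth_on_const)

lemma k_smooth_on_bounded_linear:
  "bounded_linear L \<Longrightarrow> open S \<Longrightarrow> k_smooth_on k S L"
  using k_smooth_on_bounded_linear_compose[OF _ k_smooth_on_id] .

section \<open>Germs of smooth maps and their tangent maps\<close>

text \<open>
  The part of the notion of a manifold that refers to a single chart around each point.  It is
  used for manifolds and, with the charts \<open>flat\<close>, for the vector spaces on which the momenta live.
\<close>
definition charts_ok :: "('m::t2_space, 'e::real_normed_vector) charts \<Rightarrow> bool" where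
  "charts_ok A \<longleftrightarrow> fin_dim TYPE('e) \<and>
     (\<forall>p. p \<in> chart_dom A p \<and> open (chart_dom A p) \<and> open (chart A p ` chart_dom A p) \<and>
          homeomorphism (chart_dom A p) (chart A p ` chart_dom A p) (chart A p) (chart_inv A p))"

text \<open>
  Smoothness of the germ at p.  It involves only the charts around p and around f p, the
  same that define the tangent map, so that compositions need no change of charts.
\<close>
definition smooth_at ::
  "('m::t2_space, 'e::real_normed_vector) charts \<Rightarrow>
   ('n::t2_space, 'f::real_normed_vector) charts \<Rightarrow> ('m \<Rightarrow> 'n) \<Rightarrow> 'm \<Rightarrow> bool" where
  "smooth_at A B f p \<longleftrightarrow> isCont f p \<and>
     (\<exists>U. open U \<and> chart A p p \<in> U \<and> smooth_on U (chart B (f p) \<circ> f \<circ> chart_inv A p))"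

definition smooth_atlas :: "('m::t2_space, 'e::real_normed_vector) charts \<Rightarrow> bool" where
  "smooth_atlas A \<longleftrightarrow> charts_ok A \<and> (\<forall>p q. p \<in> chart_dom A q \<longrightarrow> smooth_at A flat (chart A q) p)"

lemma charts_okD:
  fixes A :: "('m::t2_space, 'e::real_normed_vector) charts"
  assumes "charts_ok A"
  shows charts_ok_fin_dim: "fin_dim TYPE('e)"
    and chart_dom_self: "p \<in> chart_dom A p"
    and open_chart_dom: "open (chart_dom A p)"
    and open_chart_image: "open (chart A p ` chart_dom A p)"
    and chart_homeomorphism:
      "homeomorphism (chart_dom A p) (chart A p ` chart_dom A p) (chart A p) (chart_inv A p)"
  using assms by (auto simp: charts_ok_def)

lemma chart_inv_chart: "charts_ok A \<Longrightarrow> x \<in> chart_dom A p \<Longrightarrow> chart_inv A p (chart A p x) = x"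
  by (rule homeomorphism_apply1[OF chart_homeomorphism])

lemma chart_in_image: "charts_ok A \<Longrightarrow> chart A p p \<in> chart A p ` chart_dom A p"
  using chart_dom_self by blast

lemma chart_inv_chart_self: "charts_ok A \<Longrightarrow> chart_inv A p (chart A p p) = p"
  by (simp add: chart_inv_chart chart_dom_self)

lemma chart_neighbourhood:
  assumes A: "charts_ok A" and f: "isCont f p" and W: "open W" "f p \<in> W"
  obtains V where "open V" "chart A p p \<in> V" "V \<subseteq> chart A p ` chart_dom A p"
    "\<forall>x\<in>V. f (chart_inv A p x) \<in> W"
proof -
  obtain T where T: "open T" "p \<in> T" "\<And>x. x \<in> T \<Longrightarrow> f x \<in> W"
    using f[unfolded continuous_at_open, rule_format, of W] W by auto
  let ?V = "chart A p ` (chart_dom A p \<inter> T)"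
  have "openin (top_of_set (chart A p ` chart_dom A p)) ?V"
    by (rule homeomorphism_imp_open_map[OF chart_homeomorphism[OF A] openin_open_Int[OF T(1)]])
  then have "open ?V"
    by (rule openin_open_trans[OF _ open_chart_image[OF A]])
  then show thesis
  proof (rule that)
    show "chart A p p \<in> ?V" using T(2) chart_dom_self[OF A] by blast
    show "?V \<subseteq> chart A p ` chart_dom A p" by blast
    show "\<forall>x\<in>?V. f (chart_inv A p x) \<in> W"
      using T(3) by (auto simp: chart_inv_chart[OF A])
  qed
qed

lemma smooth_at_isCont: "smooth_at A B f p \<Longrightarrow> isCont f p"
  by (simp add: smooth_at_def)

lemma smooth_onD: "smooth_on S f \<Longrightarrow> k_smooth_on k S f"
  by (simp add: smooth_on_def)

lemma smooth_on_subset: "smooth_on S f \<Longrightarrow> T \<subseteq> S \<Longrightarrow> smooth_on T f"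
  unfolding smooth_on_def using k_smooth_on_subset by blast

lemma has_derivative_tangent:
  assumes "smooth_at A B f p"
  shows "((chart B (f p) \<circ> f \<circ> chart_inv A p) has_derivative tangent A B f p) (at (chart A p p))"
proof -
  obtain U where "chart A p p \<in> U" "smooth_on U (chart B (f p) \<circ> f \<circ> chart_inv A p)"
    using assms by (auto simp: smooth_at_def)
  then have "k_smooth_on (Suc 0) U (chart B (f p) \<circ> f \<circ> chart_inv A p)"
    unfolding smooth_on_def by blast
  then have "(chart B (f p) \<circ> f \<circ> chart_inv A p) differentiable (at (chart A p p))"
    using \<open>chart A p p \<in> U\<close> by simp
  then show ?thesis
    unfolding tangent_def by (rule has_frechet_derivative)
qed

lemma tangent_eqI:
  "((chart B (f p) \<circ> f \<circ> chart_inv A p) has_derivative f') (at (chart A p p)) \<Longrightarrow> tangent A B f p = f'"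
  unfolding tangent_def by (rule frechet_derivative_eqI)

lemma bounded_linear_tangent: "smooth_at A B f p \<Longrightarrow> bounded_linear (tangent A B f p)"
  using has_derivative_tangent has_derivative_bounded_linear by blast

lemma linear_tangent: "smooth_at A B f p \<Longrightarrow> linear (tangent A B f p)"
  using bounded_linear_tangent bounded_linear.linear by blast

text \<open>
  The chain rule for tangent maps.  Smoothness and derivative of a composition come from the same
  identity of coordinate representations near p, and are obtained together.
\<close>
lemma smooth_at_compose_tangent:
  assumes A: "charts_ok A" and B: "charts_ok B"
    and f: "smooth_at A B f p" and g: "smooth_at B C g (f p)"
  shows "smooth_at A C (\<lambda>x. g (f x)) p \<and>
    tangent A C (\<lambda>x. g (f x)) p = (\<lambda>v. tangent B C g (f p) (tangent A B f p v))"
proof -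
  define F where "F = chart B (f p) \<circ> f \<circ> chart_inv A p"
  define G where "G = chart C (g (f p)) \<circ> g \<circ> chart_inv B (f p)"
  define K where "K = chart C (g (f p)) \<circ> (\<lambda>x. g (f x)) \<circ> chart_inv A p"
  obtain U where U: "open U" "chart A p p \<in> U" "smooth_on U F"
    using f by (auto simp: smooth_at_def F_def)
  obtain U' where U': "open U'" "chart B (f p) (f p) \<in> U'" "smooth_on U' G"
    using g by (auto simp: smooth_at_def G_def)
  obtain V where V: "open V" "chart A p p \<in> V" "V \<subseteq> chart A p ` chart_dom A p"
      "\<forall>x\<in>V. f (chart_inv A p x) \<in> chart_dom B (f p)"
    by (rule chart_neighbourhood[where W = "chart_dom B (f p)", OF A smooth_at_isCont[OF f] open_chart_dom[OF B] chart_dom_self[OF B]])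
  have F0: "F (chart A p p) = chart B (f p) (f p)"
    by (simp add: F_def chart_inv_chart_self[OF A])
  define W where "W = (U \<inter> V) \<inter> F -` U'"
  have contF: "continuous_on (U \<inter> V) F"
    using k_smooth_on_imp_continuous_on[OF smooth_onD[OF U(3), of 0]]
    by (rule continuous_on_subset) blast
  have W: "open W" "chart A p p \<in> W"
    using continuous_open_preimage[OF contF open_Int[OF U(1) V(1)] U'(1)] U(2) V(2) U'(2) F0
    unfolding W_def by simp_all
  have KGF: "G (F x) = K x" if "x \<in> W" for x
    using V(4) that by (simp add: W_def G_def F_def K_def chart_inv_chart[OF B])
  have "k_smooth_on k W K" for k
  proof (rule k_smooth_on_cong[OF W(1) KGF])
    show "k_smooth_on k W (\<lambda>x. G (F x))"
      by (rule k_smooth_on_compose[where T = U', OF charts_ok_fin_dim[OF B] W(1)])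
        (use smooth_onD[OF U'(3)] k_smooth_on_subset[OF smooth_onD[OF U(3)], of W] in \<open>auto simp: W_def\<close>)
  qed
  then have "smooth_on W K" by (simp add: smooth_on_def)
  moreover have "isCont (\<lambda>x. g (f x)) p"
    by (rule isCont_o2[OF smooth_at_isCont[OF f] smooth_at_isCont[OF g]])
  ultimately have "smooth_at A C (\<lambda>x. g (f x)) p"
    unfolding smooth_at_def using W unfolding K_def by blast
  moreover have "((\<lambda>x. G (F x)) has_derivative (\<lambda>v. tangent B C g (f p) (tangent A B f p v)))
      (at (chart A p p))"
    by (rule has_derivative_compose[OF has_derivative_tangent[OF f, folded F_def]])
      (unfold F0, rule has_derivative_tangent[OF g, folded G_def])
  then have "(K has_derivative (\<lambda>v. tangent B C g (f p) (tangent A B f p v))) (at (chart A p p))"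
    using has_derivative_cong_open[OF W KGF] by simp
  then have "tangent A C (\<lambda>x. g (f x)) p = (\<lambda>v. tangent B C g (f p) (tangent A B f p v))"
    unfolding K_def by (rule tangent_eqI)
  ultimately show ?thesis by blast
qed

lemmas smooth_at_compose = smooth_at_compose_tangent[THEN conjunct1]
lemmas tangent_compose = smooth_at_compose_tangent[THEN conjunct2]

lemma chart_dom_prod [simp]: "chart_dom (A \<times>\<^sub>c B) (p, q) = chart_dom A p \<times> chart_dom B q"
  and chart_prod [simp]: "chart (A \<times>\<^sub>c B) (p, q) (x, y) = (chart A p x, chart B q y)"
  by (simp_all add: prod_charts_def)

lemma chart_flat [simp]: "chart flat p = (\<lambda>x. x)" "chart_dom flat p = UNIV"
  by (simp_all add: flat_def)

lemma chart_inv_flat [simp]: "chart_inv flat p = (\<lambda>x. x)"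
  unfolding chart_inv_def by (simp add: inv_equality flip: id_def)

lemma flat_prod_flat: "flat \<times>\<^sub>c flat = flat"
  by (auto simp: prod_charts_def flat_def fun_eq_iff)

lemma chart_image_prod:
  "chart (A \<times>\<^sub>c B) (p, q) ` (chart_dom A p \<times> chart_dom B q) =
     chart A p ` chart_dom A p \<times> chart B q ` chart_dom B q"
  by force

lemma inj_on_chart: "charts_ok A \<Longrightarrow> inj_on (chart A p) (chart_dom A p)"
  by (metis chart_inv_chart inj_onI)

lemma chart_inv_prod:
  assumes A: "charts_ok A" and B: "charts_ok B"
    and x: "x \<in> chart A p ` chart_dom A p" and y: "y \<in> chart B q ` chart_dom B q"
  shows "chart_inv (A \<times>\<^sub>c B) (p, q) (x, y) = (chart_inv A p x, chart_inv B q y)"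
proof -
  obtain a b where ab: "x = chart A p a" "a \<in> chart_dom A p" "y = chart B q b" "b \<in> chart_dom B q"
    using x y by auto
  have "inj_on (chart (A \<times>\<^sub>c B) (p, q)) (chart_dom A p \<times> chart_dom B q)"
    using inj_on_chart[OF A, of p] inj_on_chart[OF B, of q] by (auto simp: inj_on_def)
  then have "chart_inv (A \<times>\<^sub>c B) (p, q) (chart (A \<times>\<^sub>c B) (p, q) (a, b)) = (a, b)"
    unfolding chart_inv_def by (subst inv_into_f_f) (use ab in auto)
  then show ?thesis using ab chart_inv_chart[OF A] chart_inv_chart[OF B] by simp
qed

lemma charts_ok_prod:
  fixes A :: "('m::t2_space, 'e::real_normed_vector) charts"
    and B :: "('n::t2_space, 'f::real_normed_vector) charts"
  assumes A: "charts_ok A" and B: "charts_ok B"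
  shows "charts_ok (A \<times>\<^sub>c B)"
proof -
  have "homeomorphism (chart_dom A p \<times> chart_dom B q)
     (chart A p ` chart_dom A p \<times> chart B q ` chart_dom B q)
     (chart (A \<times>\<^sub>c B) (p, q)) (chart_inv (A \<times>\<^sub>c B) (p, q))" for p q
  proof (rule homeomorphismI)
    note hA = chart_homeomorphism[OF A, of p] and hB = chart_homeomorphism[OF B, of q]
    have "continuous_on (chart_dom A p \<times> chart_dom B q) (\<lambda>z. (chart A p (fst z), chart B q (snd z)))"
      by (intro continuous_on_Pair continuous_on_compose2[OF homeomorphism_cont1[OF hA]]
          continuous_on_compose2[OF homeomorphism_cont1[OF hB]] continuous_intros) auto
    then show "continuous_on (chart_dom A p \<times> chart_dom B q) (chart (A \<times>\<^sub>c B) (p, q))"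
      by (rule continuous_on_eq) auto
    have "continuous_on (chart A p ` chart_dom A p \<times> chart B q ` chart_dom B q)
        (\<lambda>z. (chart_inv A p (fst z), chart_inv B q (snd z)))"
      by (intro continuous_on_Pair continuous_on_compose2[OF homeomorphism_cont2[OF hA]]
          continuous_on_compose2[OF homeomorphism_cont2[OF hB]] continuous_intros) auto
    then show "continuous_on (chart A p ` chart_dom A p \<times> chart B q ` chart_dom B q)
        (chart_inv (A \<times>\<^sub>c B) (p, q))"
      by (rule continuous_on_eq) (use chart_inv_prod[OF A B] in auto)
  qed (use chart_inv_prod[OF A B] chart_inv_chart[OF A] chart_inv_chart[OF B] in auto)
  then show ?thesis
    unfolding charts_ok_def
    using A B open_chart_image[OF A] open_chart_image[OF B]
    by (auto simp: chart_image_prod intro!: fin_dim_prod open_Times charts_ok_fin_dim[OF A]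
        charts_ok_fin_dim[OF B] open_chart_dom chart_dom_self)
qed

lemma charts_ok_flat: "fin_dim TYPE('v::real_normed_vector) \<Longrightarrow> charts_ok (flat :: ('v, 'v) charts)"
  by (auto simp: charts_ok_def homeomorphism_def)

lemma smooth_at_const: "smooth_at A B (\<lambda>x. c) p"
  by (auto simp: smooth_at_def smooth_on_def comp_def k_smooth_on_const intro!: exI[of _ UNIV])

lemma tangent_const: "tangent A B (\<lambda>x. c) p = (\<lambda>v. 0)"
  unfolding tangent_def comp_def by simp

lemma smooth_at_tangentI:
  assumes "isCont f p" "open U" "chart A p p \<in> U" "bounded_linear L"
    "\<And>x. x \<in> U \<Longrightarrow> chart B (f p) (f (chart_inv A p x)) = L x"
  shows "smooth_at A B f p \<and> tangent A B f p = L"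
proof
  have "k_smooth_on k U (chart B (f p) \<circ> f \<circ> chart_inv A p)" for k
    by (rule k_smooth_on_cong[OF assms(2) _ k_smooth_on_bounded_linear[OF assms(4,2)]])
      (simp add: assms(5))
  then show "smooth_at A B f p"
    using assms unfolding smooth_at_def smooth_on_def by blast
  show "tangent A B f p = L"
    by (rule tangent_eqI, subst has_derivative_cong_open[OF assms(2,3), where g = L])
      (use assms(5) bounded_linear_imp_has_derivative[OF assms(4)] in auto)
qed

lemma smooth_at_id_tangent:
  assumes A: "charts_ok A"
  shows "smooth_at A A (\<lambda>x. x) p \<and> tangent A A (\<lambda>x. x) p = (\<lambda>v. v)"
  by (rule smooth_at_tangentI[OF _ open_chart_image[OF A] chart_in_image[OF A]])
    (auto simp: chart_inv_chart[OF A] bounded_linear_ident)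

lemma smooth_at_fst:
  assumes A: "charts_ok A" and B: "charts_ok B"
  shows "smooth_at (A \<times>\<^sub>c B) A fst p"
proof (cases p)
  case (Pair a b)
  show ?thesis
    unfolding Pair
    by (rule smooth_at_tangentI[where U = "chart A a ` chart_dom A a \<times> chart B b ` chart_dom B b"
          and L = fst, THEN conjunct1])
      (auto intro!: open_Times open_chart_image A B chart_in_image bounded_linear_fst continuous_intros
        simp: chart_inv_prod[OF A B] chart_inv_chart[OF A] chart_dom_self[OF A] chart_dom_self[OF B])
qed

lemma smooth_at_snd:
  assumes A: "charts_ok A" and B: "charts_ok B"
  shows "smooth_at (A \<times>\<^sub>c B) B snd p"
proof (cases p)
  case (Pair a b)
  show ?thesis
    unfolding Pair
    by (rule smooth_at_tangentI[where U = "chart A a ` chart_dom A a \<times> chart B b ` chart_dom B b"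
          and L = snd, THEN conjunct1])
      (auto intro!: open_Times open_chart_image A B chart_in_image bounded_linear_snd continuous_intros
        simp: chart_inv_prod[OF A B] chart_inv_chart[OF B] chart_dom_self[OF A] chart_dom_self[OF B])
qed

lemma smooth_at_Pair_tangent:
  assumes f: "smooth_at A B f p" and g: "smooth_at A C g p"
  shows "smooth_at A (B \<times>\<^sub>c C) (\<lambda>x. (f x, g x)) p \<and>
    tangent A (B \<times>\<^sub>c C) (\<lambda>x. (f x, g x)) p = (\<lambda>v. (tangent A B f p v, tangent A C g p v))"
proof
  let ?F = "chart B (f p) \<circ> f \<circ> chart_inv A p" and ?G = "chart C (g p) \<circ> g \<circ> chart_inv A p"
  have rep: "chart (B \<times>\<^sub>c C) (f p, g p) \<circ> (\<lambda>x. (f x, g x)) \<circ> chart_inv A p = (\<lambda>x. (?F x, ?G x))"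
    by (auto simp: fun_eq_iff)
  obtain U where U: "open U" "chart A p p \<in> U" "smooth_on U ?F"
    using f unfolding smooth_at_def by blast
  obtain V where V: "open V" "chart A p p \<in> V" "smooth_on V ?G"
    using g unfolding smooth_at_def by blast
  have "smooth_on (U \<inter> V) (\<lambda>x. (?F x, ?G x))"
    using k_smooth_on_Pair[OF open_Int[OF U(1) V(1)] smooth_onD[OF smooth_on_subset[OF U(3)]]
        smooth_onD[OF smooth_on_subset[OF V(3)]]]
    by (auto simp: smooth_on_def)
  moreover have "isCont (\<lambda>x. (f x, g x)) p"
    using f g by (auto simp: smooth_at_def intro: continuous_intros)
  ultimately show "smooth_at A (B \<times>\<^sub>c C) (\<lambda>x. (f x, g x)) p"
    unfolding smooth_at_def rep using U(1,2) V(1,2) by (intro conjI exI[of _ "U \<inter> V"]) auto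
  show "tangent A (B \<times>\<^sub>c C) (\<lambda>x. (f x, g x)) p = (\<lambda>v. (tangent A B f p v, tangent A C g p v))"
    by (rule tangent_eqI, unfold rep)
      (intro has_derivative_Pair has_derivative_tangent f g)
qed

lemmas smooth_at_id = smooth_at_id_tangent[THEN conjunct1]
lemmas tangent_id = smooth_at_id_tangent[THEN conjunct2]
lemmas smooth_at_Pair = smooth_at_Pair_tangent[THEN conjunct1]
lemmas tangent_Pair = smooth_at_Pair_tangent[THEN conjunct2]

text \<open>The partial maps are compositions with the inclusions x \<mapsto> (x, q) and y \<mapsto> (p, y).\<close>
lemma smooth_at_partial:
  assumes A: "charts_ok A" and B: "charts_ok B" and F: "smooth_at (A \<times>\<^sub>c B) C F (p, q)"
  shows smooth_at_partial1: "smooth_at A C (\<lambda>x. F (x, q)) p"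
    and smooth_at_partial2: "smooth_at B C (\<lambda>y. F (p, y)) q"
    and tangent_partial: "tangent (A \<times>\<^sub>c B) C F (p, q) (v, w) =
      tangent A C (\<lambda>x. F (x, q)) p v + tangent B C (\<lambda>y. F (p, y)) q w"
proof -
  note AB = charts_ok_prod[OF A B]
  have 1: "smooth_at A (A \<times>\<^sub>c B) (\<lambda>x. (x, q)) p" "tangent A (A \<times>\<^sub>c B) (\<lambda>x. (x, q)) p = (\<lambda>v. (v, 0))"
    using smooth_at_Pair_tangent[OF smooth_at_id[OF A] smooth_at_const, of B q p]
    by (simp_all add: tangent_id[OF A] tangent_const)
  have 2: "smooth_at B (A \<times>\<^sub>c B) (\<lambda>y. (p, y)) q" "tangent B (A \<times>\<^sub>c B) (\<lambda>y. (p, y)) q = (\<lambda>w. (0, w))"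
    using smooth_at_Pair_tangent[OF smooth_at_const smooth_at_id[OF B], of A p q]
    by (simp_all add: tangent_id[OF B] tangent_const)
  show "smooth_at A C (\<lambda>x. F (x, q)) p" using smooth_at_compose[OF A AB 1(1) F] .
  show "smooth_at B C (\<lambda>y. F (p, y)) q" using smooth_at_compose[OF B AB 2(1) F] .
  have "tangent (A \<times>\<^sub>c B) C F (p, q) ((v, 0) + (0, w)) =
      tangent (A \<times>\<^sub>c B) C F (p, q) (v, 0) + tangent (A \<times>\<^sub>c B) C F (p, q) (0, w)"
    by (rule linear_add[OF linear_tangent[OF F]])
  then show "tangent (A \<times>\<^sub>c B) C F (p, q) (v, w) =
      tangent A C (\<lambda>x. F (x, q)) p v + tangent B C (\<lambda>y. F (p, y)) q w"
    using tangent_compose[OF A AB 1(1) F] tangent_compose[OF B AB 2(1) F]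
    by (simp add: 1(2) 2(2))
qed

lemma subset_chart_image:
  assumes A: "charts_ok A" and V: "V \<subseteq> chart A p ` chart_dom A p" "\<forall>x\<in>V. chart_inv A p x \<in> W"
  shows "V \<subseteq> chart A p ` (chart_dom A p \<inter> W)"
proof
  fix x assume x: "x \<in> V"
  with V(1) obtain a where a: "x = chart A p a" "a \<in> chart_dom A p" by blast
  then have "a \<in> W" using bspec[OF V(2) x] by (simp add: chart_inv_chart[OF A])
  with a show "x \<in> chart A p ` (chart_dom A p \<inter> W)" by blast
qed

lemma smooth_map_imp_smooth_at:
  assumes A: "charts_ok A" and B: "charts_ok B" and f: "smooth_map A B f"
  shows "smooth_at A B f p"
proof -
  have cont: "isCont f p"
    using f by (simp add: smooth_map_def continuous_on_eq_continuous_at)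
  obtain V where V: "open V" "chart A p p \<in> V" "V \<subseteq> chart A p ` chart_dom A p"
      "\<forall>x\<in>V. f (chart_inv A p x) \<in> chart_dom B (f p)"
    by (rule chart_neighbourhood[where W = "chart_dom B (f p)", OF A cont open_chart_dom[OF B] chart_dom_self[OF B]])
  have "V \<subseteq> chart A p ` (chart_dom A p \<inter> f -` chart_dom B (f p))"
    using V(4) by (intro subset_chart_image[OF A V(3)]) simp
  moreover have "smooth_on (chart A p ` (chart_dom A p \<inter> f -` chart_dom B (f p)))
      (chart B (f p) \<circ> f \<circ> chart_inv A p)"
    using f by (simp add: smooth_map_def)
  ultimately have "smooth_on V (chart B (f p) \<circ> f \<circ> chart_inv A p)"
    by (rule smooth_on_subset[rotated])
  then show ?thesis
    unfolding smooth_at_def using cont V(1,2) by blast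
qed

lemma smooth_manifold_imp_smooth_atlas:
  fixes A :: "('m::{t2_space, second_countable_topology}, 'e::real_normed_vector) charts"
  assumes A: "smooth_manifold A"
  shows "smooth_atlas A"
proof -
  obtain B :: "'e set" where "finite_dimensional_vector_space (*\<^sub>R) B"
    using A by (auto simp: smooth_manifold_def)
  then have "finite B" "span B = UNIV"
    by (simp_all add: finite_dimensional_vector_space.finite_Basis
        finite_dimensional_vector_space.span_Basis span_raw_def)
  then have ok: "charts_ok A"
    using A by (auto simp: charts_ok_def smooth_manifold_def fin_dim_def)
  have "smooth_at A flat (chart A q) p" if q: "p \<in> chart_dom A q" for p q
  proof -
    have cont: "isCont (chart A q) p"
      using homeomorphism_cont1[OF chart_homeomorphism[OF ok]] q
      by (simp add: continuous_on_eq_continuous_at[OF open_chart_dom[OF ok]])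
    obtain V where V: "open V" "chart A p p \<in> V" "V \<subseteq> chart A p ` chart_dom A p"
      "\<forall>x\<in>V. chart_inv A p x \<in> chart_dom A q"
      by (rule chart_neighbourhood[where W = "chart_dom A q" and f = "\<lambda>x. x", OF ok _ open_chart_dom[OF ok] q]) simp_all
    have "V \<subseteq> chart A p ` (chart_dom A p \<inter> chart_dom A q)"
      by (rule subset_chart_image[OF ok V(3,4)])
    moreover have "smooth_on (chart A p ` (chart_dom A p \<inter> chart_dom A q)) (chart A q \<circ> chart_inv A p)"
      using A by (simp add: smooth_manifold_def)
    ultimately have "smooth_on V (chart A q \<circ> chart_inv A p)"
      by (rule smooth_on_subset[rotated])
    with cont V(1,2) show ?thesis
      unfolding smooth_at_def by (auto simp: comp_def)
  qed
  with ok show ?thesis by (simp add: smooth_atlas_def)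
qed

lemma smooth_atlas_prod:
  fixes A :: "('m::t2_space, 'e::real_normed_vector) charts"
    and B :: "('n::t2_space, 'f::real_normed_vector) charts"
  assumes "smooth_atlas A" "smooth_atlas B"
  shows "smooth_atlas (A \<times>\<^sub>c B)"
proof -
  have A: "charts_ok A" and B: "charts_ok B" using assms by (auto simp: smooth_atlas_def)
  have "smooth_at (A \<times>\<^sub>c B) flat (chart (A \<times>\<^sub>c B) (a, b)) (p, q)"
    if "p \<in> chart_dom A a" "q \<in> chart_dom B b" for p q a b
  proof -
    have "smooth_at (A \<times>\<^sub>c B) flat (\<lambda>z. chart A a (fst z)) (p, q)"
      by (rule smooth_at_compose[OF charts_ok_prod[OF A B] A smooth_at_fst[OF A B]])
        (use assms that in \<open>auto simp: smooth_atlas_def\<close>)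
    moreover have "smooth_at (A \<times>\<^sub>c B) flat (\<lambda>z. chart B b (snd z)) (p, q)"
      by (rule smooth_at_compose[OF charts_ok_prod[OF A B] B smooth_at_snd[OF A B]])
        (use assms that in \<open>auto simp: smooth_atlas_def\<close>)
    ultimately have "smooth_at (A \<times>\<^sub>c B) (flat \<times>\<^sub>c flat) (\<lambda>z. (chart A a (fst z), chart B b (snd z))) (p, q)"
      by (rule smooth_at_Pair)
    moreover have "(\<lambda>z. (chart A a (fst z), chart B b (snd z))) = chart (A \<times>\<^sub>c B) (a, b)"
      by auto
    ultimately show ?thesis by (simp add: flat_prod_flat)
  qed
  then show ?thesis
    using charts_ok_prod[OF A B] by (auto simp: smooth_atlas_def)
qed

lemma smooth_at_binop:
  assumes A: "charts_ok A" and B: "charts_ok B" and C: "charts_ok C"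
    and "smooth_at C A f z" "smooth_at C B g z"
    and "smooth_at (A \<times>\<^sub>c B) D (\<lambda>(x, y). F x y) (f z, g z)"
  shows "smooth_at C D (\<lambda>z. F (f z) (g z)) z"
  using smooth_at_compose[OF C charts_ok_prod[OF A B] smooth_at_Pair[OF assms(4,5)] assms(6)]
  by simp

section \<open>The bracket of left-invariant vector fields\<close>

text \<open>
  The common setting for H and for the double cross product: the bracket of left-invariant fields
  is computed from the multiplication near the unit.
\<close>
locale smooth_unital_magma =
  fixes A :: "('g::t2_space, 'e::real_normed_vector) charts" and G :: "'g monoid" (structure)
  assumes atlas: "smooth_atlas A"
    and smooth_mult: "smooth_at (A \<times>\<^sub>c A) A (\<lambda>(x, y). x \<otimes> y) p"
    and right_unit: "g \<otimes> \<one> = g"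
begin

lemma charts_ok: "charts_ok A"
  using atlas by (simp add: smooth_atlas_def)

lemma smooth_left_translation: "smooth_at A A (\<lambda>x. g \<otimes> x) k"
  using smooth_at_partial2[OF charts_ok charts_ok smooth_mult] by simp

lemma smooth_right_translation: "smooth_at A A (\<lambda>x. x \<otimes> k) g"
  using smooth_at_partial1[OF charts_ok charts_ok smooth_mult] by simp

lemma linear_left_invariant: "linear (\<lambda>v. left_invariant A G v g)"
  unfolding left_invariant_def by (rule linear_tangent[OF smooth_left_translation])

text \<open>
  Let F be the multiplication in the chart around the unit.  For x in that chart, the left-invariant field
  generated by v has at x the components D F(x, 1)(0, v), by the chain rule for
  left translation followed by the chart.  This expression is linear in v, and differentiable in x
  because F is twice differentiable.
\<close>
lemma field_rep_left_invariant:
  obtains F U where "open U" "chart A \<one> \<one> \<in> U"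
    "\<forall>x\<in>U. F differentiable (at (x, chart A \<one> \<one>))"
    "\<forall>v. (\<lambda>x. frechet_derivative F (at (x, chart A \<one> \<one>)) (0, v)) differentiable (at (chart A \<one> \<one>))"
    "\<forall>x\<in>U. \<forall>v. field_rep A (left_invariant A G v) \<one> x
        = frechet_derivative F (at (x, chart A \<one> \<one>)) (0, v)"
proof -
  let ?x0 = "chart A \<one> \<one>" and ?I = "chart A \<one> ` chart_dom A \<one>"
  define F where "F = chart A \<one> \<circ> (\<lambda>(x, y). x \<otimes> y) \<circ> chart_inv (A \<times>\<^sub>c A) (\<one>, \<one>)"
  obtain W where W: "open W" "(?x0, ?x0) \<in> W" "smooth_on W F"
    using smooth_mult[of "(\<one>, \<one>)"] by (auto simp: smooth_at_def right_unit F_def)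
  define U where "U = ?I \<inter> (\<lambda>x. (x, ?x0)) -` W"
  have U: "open U" "?x0 \<in> U"
    unfolding U_def
    by (rule continuous_open_preimage[OF _ open_chart_image[OF charts_ok] W(1)])
      (auto intro: continuous_intros chart_in_image[OF charts_ok] W(2))
  have dF: "F differentiable (at z)" if "z \<in> W" for z
    using smooth_onD[OF W(3), of "Suc 0"] that by simp
  have "k_smooth_on (Suc 0) W (\<lambda>z. frechet_derivative F (at z) (0, v))" for v
    using smooth_onD[OF W(3), of "Suc (Suc 0)"] unfolding k_smooth_on.simps(2)[of "Suc 0"] by blast
  then have d2F: "(\<lambda>z. frechet_derivative F (at z) (0, v)) differentiable (at (?x0, ?x0))" for v
    using W(2) by simp
  have pair1: "((\<lambda>x. (x, ?x0)) has_derivative (\<lambda>v. (v, 0))) (at x)" for x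
    by (intro has_derivative_Pair has_derivative_ident has_derivative_const)
  have pair2: "((\<lambda>y. (x, y)) has_derivative (\<lambda>v. (0, v))) (at ?x0)" for x :: 'e
    by (intro has_derivative_Pair has_derivative_ident has_derivative_const)
  have "(\<lambda>x. frechet_derivative F (at (x, ?x0)) (0, v)) differentiable (at ?x0)" for v
    using has_derivative_compose[OF pair1 has_frechet_derivative[OF d2F]]
    unfolding differentiable_def by blast
  moreover have "field_rep A (left_invariant A G v) \<one> x = frechet_derivative F (at (x, ?x0)) (0, v)"
    if x: "x \<in> U" for x v
  proof -
    define g where "g = chart_inv A \<one> x"
    have xI: "x \<in> ?I" and xW: "(x, ?x0) \<in> W" using x by (auto simp: U_def)
    then have g: "g \<in> chart_dom A \<one>" by (auto simp: g_def chart_inv_chart[OF charts_ok])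
    then have smooth_chart: "smooth_at A flat (chart A \<one>) (g \<otimes> \<one>)"
      using atlas by (simp add: smooth_atlas_def right_unit)
    have "field_rep A (left_invariant A G v) \<one> x = tangent A flat (\<lambda>y. chart A \<one> (g \<otimes> y)) \<one> v"
      using tangent_compose[OF charts_ok charts_ok smooth_left_translation smooth_chart]
      by (simp add: field_rep_def left_invariant_def g_def[symmetric] right_unit)
    moreover have "((\<lambda>y. F (x, y)) has_derivative (\<lambda>v. frechet_derivative F (at (x, ?x0)) (0, v))) (at ?x0)"
      by (rule has_derivative_compose[OF pair2 has_frechet_derivative[OF dF[OF xW]]])
    then have "(chart flat (chart A \<one> (g \<otimes> \<one>)) \<circ> (\<lambda>y. chart A \<one> (g \<otimes> y)) \<circ> chart_inv A \<one>
        has_derivative (\<lambda>v. frechet_derivative F (at (x, ?x0)) (0, v))) (at ?x0)"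
      by (rule has_derivative_transform_within_open[OF _ open_chart_image[OF charts_ok] chart_in_image[OF charts_ok]])
        (simp add: F_def chart_inv_prod[OF charts_ok charts_ok xI] g_def)
    then have "tangent A flat (\<lambda>y. chart A \<one> (g \<otimes> y)) \<one> = (\<lambda>v. frechet_derivative F (at (x, ?x0)) (0, v))"
      by (rule tangent_eqI)
    ultimately show ?thesis by simp
  qed
  moreover have "\<forall>x\<in>U. F differentiable (at (x, ?x0))"
    using dF by (simp add: U_def)
  ultimately show thesis
    using that[OF U] by blast
qed

lemma field_rep_has_derivative:
  "(field_rep A (left_invariant A G v) \<one> has_derivative
     frechet_derivative (field_rep A (left_invariant A G v) \<one>) (at (chart A \<one> \<one>))) (at (chart A \<one> \<one>))"
proof -
  obtain F U where FU: "open U" "chart A \<one> \<one> \<in> U"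
    "\<forall>v. (\<lambda>x. frechet_derivative F (at (x, chart A \<one> \<one>)) (0, v)) differentiable (at (chart A \<one> \<one>))"
    "\<forall>x\<in>U. \<forall>v. field_rep A (left_invariant A G v) \<one> x
        = frechet_derivative F (at (x, chart A \<one> \<one>)) (0, v)"
    by (rule field_rep_left_invariant) (rule that)
  from FU(3) obtain D where "((\<lambda>x. frechet_derivative F (at (x, chart A \<one> \<one>)) (0, v)) has_derivative D)
      (at (chart A \<one> \<one>))"
    unfolding differentiable_def by blast
  then have "(field_rep A (left_invariant A G v) \<one> has_derivative D) (at (chart A \<one> \<one>))"
    by (rule has_derivative_transform_within_open[OF _ FU(1,2)]) (simp add: FU(4))
  then show ?thesis
    by (simp add: frechet_derivative_eqI)
qed

lemma frechet_derivative_field_rep_combination: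
  "frechet_derivative (field_rep A (left_invariant A G (a *\<^sub>R v + w)) \<one>) (at (chart A \<one> \<one>)) u
   = a *\<^sub>R frechet_derivative (field_rep A (left_invariant A G v) \<one>) (at (chart A \<one> \<one>)) u
     + frechet_derivative (field_rep A (left_invariant A G w) \<one>) (at (chart A \<one> \<one>)) u"
proof -
  obtain F U where FU: "open U" "chart A \<one> \<one> \<in> U"
    "\<forall>x\<in>U. F differentiable (at (x, chart A \<one> \<one>))"
    "\<forall>x\<in>U. \<forall>v. field_rep A (left_invariant A G v) \<one> x
        = frechet_derivative F (at (x, chart A \<one> \<one>)) (0, v)"
    by (rule field_rep_left_invariant) (rule that)
  have sum: "a *\<^sub>R field_rep A (left_invariant A G v) \<one> x + field_rep A (left_invariant A G w) \<one> x
      = field_rep A (left_invariant A G (a *\<^sub>R v + w)) \<one> x" if x: "x \<in> U" for x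
  proof -
    have lin: "linear (frechet_derivative F (at (x, chart A \<one> \<one>)))"
      using FU(3) x by (simp add: linear_frechet_derivative)
    show ?thesis
      using linear_add[OF lin, of "a *\<^sub>R (0, v)" "(0, w)"] linear_cmul[OF lin, of a "(0, v)"] FU(4) x
      by simp
  qed
  have "((\<lambda>x. a *\<^sub>R field_rep A (left_invariant A G v) \<one> x + field_rep A (left_invariant A G w) \<one> x)
     has_derivative (\<lambda>u. a *\<^sub>R frechet_derivative (field_rep A (left_invariant A G v) \<one>) (at (chart A \<one> \<one>)) u
     + frechet_derivative (field_rep A (left_invariant A G w) \<one>) (at (chart A \<one> \<one>)) u)) (at (chart A \<one> \<one>))"
    by (intro has_derivative_add has_derivative_scaleR_right field_rep_has_derivative)
  then have "(field_rep A (left_invariant A G (a *\<^sub>R v + w)) \<one>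
     has_derivative (\<lambda>u. a *\<^sub>R frechet_derivative (field_rep A (left_invariant A G v) \<one>) (at (chart A \<one> \<one>)) u
     + frechet_derivative (field_rep A (left_invariant A G w) \<one>) (at (chart A \<one> \<one>)) u)) (at (chart A \<one> \<one>))"
    by (rule has_derivative_transform_within_open[OF _ FU(1,2) sum])
  then show ?thesis by (simp add: frechet_derivative_eqI)
qed

lemma lie_bracket_antisymmetric: "lie_bracket A G v w = - lie_bracket A G w v"
  by (simp add: lie_bracket_def field_bracket_def)

lemma linear_lie_bracket_right: "linear (lie_bracket A G u)"
proof -
  have comb: "lie_bracket A G u (a *\<^sub>R v + w) = a *\<^sub>R lie_bracket A G u v + lie_bracket A G u w" for a v w
  proof -
    have lin: "linear (frechet_derivative (field_rep A (left_invariant A G u) \<one>) (at (chart A \<one> \<one>)))"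
      using field_rep_has_derivative has_derivative_linear by blast
    show ?thesis
      by (simp add: lie_bracket_def field_bracket_def frechet_derivative_field_rep_combination
          linear_add[OF linear_left_invariant] linear_cmul[OF linear_left_invariant]
          linear_add[OF lin] linear_cmul[OF lin])
        (simp add: algebra_simps)
  qed
  have zero: "lie_bracket A G u 0 = 0" using comb[of "-1" 0 0] by simp
  show ?thesis
    using comb[of 1] comb[of _ _ 0] zero by (intro linearI) auto
qed

lemma linear_lie_bracket_left: "linear (\<lambda>v. lie_bracket A G v w)"
  by (subst lie_bracket_antisymmetric) (intro linear_compose_neg linear_lie_bracket_right)

end

section \<open>The Lie algebra of the double cross product\<close>
lemma lie_group_smooth_unital_magma:
  assumes "lie_group A G"
  shows "smooth_unital_magma A G"
proof
  have G: "smooth_manifold A" "group G" "carrier G = UNIV"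
    "smooth_map (A \<times>\<^sub>c A) A (\<lambda>(x, y). x \<otimes>\<^bsub>G\<^esub> y)"
    using assms by (auto simp: lie_group_def)
  show "smooth_atlas A" by (rule smooth_manifold_imp_smooth_atlas[OF G(1)])
  then have ok: "charts_ok A" by (simp add: smooth_atlas_def)
  show "smooth_at (A \<times>\<^sub>c A) A (\<lambda>(x, y). x \<otimes>\<^bsub>G\<^esub> y) p" for p
    by (rule smooth_map_imp_smooth_at[OF charts_ok_prod[OF ok ok] ok G(4)])
  show "g \<otimes>\<^bsub>G\<^esub> \<one>\<^bsub>G\<^esub> = g" for g
    using group.is_monoid[OF G(2)] G(3) by (simp add: monoid.r_one)
qed

context cocycle_matched_pair
begin

abbreviation "M \<equiv> Mchts P"
abbreviation "H \<equiv> Hchts P"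

sublocale H: smooth_unital_magma H "Hgrp P"
  by (rule lie_group_smooth_unital_magma[OF lie_group])

sublocale Hgroup: group "Hgrp P"
  using lie_group by (simp add: lie_group_def)

lemma carrier_H [simp]: "carrier (Hgrp P) = UNIV"
  using lie_group by (simp add: lie_group_def)

lemma atlas_M: "smooth_atlas M"
  by (rule smooth_manifold_imp_smooth_atlas[OF manifold])

lemma ok_M: "charts_ok M"
  using atlas_M by (simp add: smooth_atlas_def)

lemma ok_HM: "charts_ok (H \<times>\<^sub>c M)" and ok_MM: "charts_ok (M \<times>\<^sub>c M)" and ok_MH: "charts_ok (M \<times>\<^sub>c H)"
  by (intro charts_ok_prod ok_M H.charts_ok)+

lemma smooth_at_act: "smooth_at (H \<times>\<^sub>c M) M (\<lambda>(h, m). h \<triangleright> m) p"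
  by (rule smooth_map_imp_smooth_at[OF ok_HM ok_M smooth_act])

lemma smooth_at_sig: "smooth_at (H \<times>\<^sub>c M) H (\<lambda>(h, m). sig P h m) p"
  by (rule smooth_map_imp_smooth_at[OF ok_HM H.charts_ok smooth_sig])

lemma smooth_at_dot: "smooth_at (M \<times>\<^sub>c M) M (\<lambda>(m, n). m \<cdot> n) p"
  by (rule smooth_map_imp_smooth_at[OF ok_MM ok_M smooth_dot])

lemma smooth_at_gam: "smooth_at (M \<times>\<^sub>c M) H (\<lambda>(m, n). gam P m n) p"
  by (rule smooth_map_imp_smooth_at[OF ok_MM H.charts_ok smooth_gam])

lemma dcp_mult: "(m, h) \<otimes>\<^bsub>dcp P\<^esub> (n, k) =
    (m \<cdot> (h \<triangleright> n), (gam P m (h \<triangleright> n) \<star> sig P h n) \<star> k)"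
  and dcp_one: "\<one>\<^bsub>dcp P\<^esub> = (pt P, hone P)"
  by (simp_all add: dcp_def)

lemma smooth_at_dcp_mult:
  "smooth_at (dcp_charts P \<times>\<^sub>c dcp_charts P) (dcp_charts P) (\<lambda>(x, y). x \<otimes>\<^bsub>dcp P\<^esub> y) p"
proof -
  let ?G = "M \<times>\<^sub>c H"
  let ?GG = "?G \<times>\<^sub>c ?G"
    have okGG: "charts_ok ?GG" by (rule charts_ok_prod[OF ok_MH ok_MH])
  have m: "smooth_at ?GG M (\<lambda>z. fst (fst z)) p"
    by (rule smooth_at_compose[OF okGG ok_MH smooth_at_fst[OF ok_MH ok_MH] smooth_at_fst[OF ok_M H.charts_ok]])
  have h: "smooth_at ?GG H (\<lambda>z. snd (fst z)) p"
    by (rule smooth_at_compose[OF okGG ok_MH smooth_at_fst[OF ok_MH ok_MH] smooth_at_snd[OF ok_M H.charts_ok]])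
  have n: "smooth_at ?GG M (\<lambda>z. fst (snd z)) p"
    by (rule smooth_at_compose[OF okGG ok_MH smooth_at_snd[OF ok_MH ok_MH] smooth_at_fst[OF ok_M H.charts_ok]])
  have k: "smooth_at ?GG H (\<lambda>z. snd (snd z)) p"
    by (rule smooth_at_compose[OF okGG ok_MH smooth_at_snd[OF ok_MH ok_MH] smooth_at_snd[OF ok_M H.charts_ok]])
  note hn = smooth_at_binop[OF H.charts_ok ok_M okGG h n smooth_at_act]
  note shn = smooth_at_binop[OF H.charts_ok ok_M okGG h n smooth_at_sig]
  note 1 = smooth_at_binop[OF ok_M ok_M okGG m hn smooth_at_dot]
  note g = smooth_at_binop[OF ok_M ok_M okGG m hn smooth_at_gam]
  note gs = smooth_at_binop[OF H.charts_ok H.charts_ok okGG g shn H.smooth_mult]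
  note 2 = smooth_at_binop[OF H.charts_ok H.charts_ok okGG gs k H.smooth_mult]
  have "(\<lambda>(x, y). x \<otimes>\<^bsub>dcp P\<^esub> y) = (\<lambda>z. (fst (fst z) \<cdot> (snd (fst z) \<triangleright> fst (snd z)),
      (gam P (fst (fst z)) (snd (fst z) \<triangleright> fst (snd z)) \<star> sig P (snd (fst z)) (fst (snd z))) \<star> snd (snd z)))"
    by (auto simp: dcp_mult)
  then show ?thesis
    unfolding dcp_charts_def using smooth_at_Pair[OF 1 2] by simp
qed

sublocale G: smooth_unital_magma "dcp_charts P" "dcp P"
proof
  show "smooth_atlas (dcp_charts P)"
    unfolding dcp_charts_def by (rule smooth_atlas_prod[OF atlas_M H.atlas])
  show "smooth_at (dcp_charts P \<times>\<^sub>c dcp_charts P) (dcp_charts P) (\<lambda>(x, y). x \<otimes>\<^bsub>dcp P\<^esub> y) p" for p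
    by (rule smooth_at_dcp_mult)
  show "g \<otimes>\<^bsub>dcp P\<^esub> \<one>\<^bsub>dcp P\<^esub> = g" for g
    by (cases g) (simp add: dcp_mult dcp_one act_pt dot_pt gam_pt sig_pt)
qed

lemma smooth_at_structure_maps:
  shows smooth_at_dot1: "smooth_at M M (\<lambda>n. n \<cdot> m) p"
    and smooth_at_gam1: "smooth_at M H (\<lambda>n. gam P n m) p"
    and smooth_at_act1: "smooth_at H M (\<lambda>k. k \<triangleright> m) q"
    and smooth_at_sig1: "smooth_at H H (\<lambda>k. sig P k m) q"
    and smooth_at_gam_mult: "smooth_at M H (\<lambda>n. gam P n m \<star> h) p"
    and smooth_at_sig_mult: "smooth_at H H (\<lambda>k. sig P k m \<star> h) q"
proof -
  show g: "smooth_at M H (\<lambda>n. gam P n m) p"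
    using smooth_at_partial1[OF ok_M ok_M smooth_at_gam] by simp
  show s: "smooth_at H H (\<lambda>k. sig P k m) q"
    using smooth_at_partial1[OF H.charts_ok ok_M smooth_at_sig] by simp
  show "smooth_at M M (\<lambda>n. n \<cdot> m) p"
    using smooth_at_partial1[OF ok_M ok_M smooth_at_dot] by simp
  show "smooth_at H M (\<lambda>k. k \<triangleright> m) q"
    using smooth_at_partial1[OF H.charts_ok ok_M smooth_at_act] by simp
  show "smooth_at M H (\<lambda>n. gam P n m \<star> h) p"
    by (rule smooth_at_compose[OF ok_M H.charts_ok g H.smooth_right_translation])
  show "smooth_at H H (\<lambda>k. sig P k m \<star> h) q"
    by (rule smooth_at_compose[OF H.charts_ok H.charts_ok s H.smooth_right_translation])
qed

text \<open>
  The two columns are the derivatives of n \<mapsto> (n, 1)(m, h) and k \<mapsto> (o, k)(m, h), which the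
  normalization conditions on \<sigma>, \<gamma> and the product reduce to (n \<cdot> m, \<gamma>(n, m) * h) and (k \<triangleright> m, \<sigma>(k, m) * h).
\<close>
lemma tangent_right_translation:
  "tangent (dcp_charts P) (dcp_charts P) (\<lambda>x. x \<otimes>\<^bsub>dcp P\<^esub> (m, h)) \<one>\<^bsub>dcp P\<^esub> (v, \<eta>) =
    (tangent M M (\<lambda>n. n \<cdot> m) (pt P) v + tangent H M (\<lambda>k. k \<triangleright> m) (hone P) \<eta>,
     tangent M H (\<lambda>n. gam P n m \<star> h) (pt P) v + tangent H H (\<lambda>k. sig P k m \<star> h) (hone P) \<eta>)"
proof -
  have "tangent (M \<times>\<^sub>c H) (M \<times>\<^sub>c H) (\<lambda>x. x \<otimes>\<^bsub>dcp P\<^esub> (m, h)) (pt P, hone P) (v, \<eta>) =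
      tangent M (M \<times>\<^sub>c H) (\<lambda>n. (n \<cdot> m, gam P n m \<star> h)) (pt P) v +
      tangent H (M \<times>\<^sub>c H) (\<lambda>k. (k \<triangleright> m, sig P k m \<star> h)) (hone P) \<eta>"
    using tangent_partial[OF ok_M H.charts_ok G.smooth_right_translation[unfolded dcp_charts_def]]
    by (simp add: dcp_mult act_one sig_one pt_dot pt_gam)
  then show ?thesis
    by (simp add: dcp_charts_def dcp_one
        tangent_Pair[OF smooth_at_dot1 smooth_at_gam_mult] tangent_Pair[OF smooth_at_act1 smooth_at_sig_mult])
qed

text \<open>
  The submanifold {o} \<times> H is closed under multiplication and carries the multiplication of H, so that
  fields generated by the Lie algebra of H are tangent to it and restrict to left-invariant fields of H.
\<close>
lemma left_invariant_dcp_H: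
  "left_invariant (dcp_charts P) (dcp P) (0, \<eta>) (pt P, h) = (0, left_invariant H (Hgrp P) \<eta> h)"
proof -
  have sm: "smooth_at (M \<times>\<^sub>c H) (M \<times>\<^sub>c H) (\<lambda>x. (pt P, h) \<otimes>\<^bsub>dcp P\<^esub> x) (pt P, hone P)"
    using G.smooth_left_translation by (simp add: dcp_charts_def)
  have "tangent (M \<times>\<^sub>c H) (M \<times>\<^sub>c H) (\<lambda>x. (pt P, h) \<otimes>\<^bsub>dcp P\<^esub> x) (pt P, hone P) (0, \<eta>)
      = tangent H (M \<times>\<^sub>c H) (\<lambda>k. (pt P, h \<star> k)) (hone P) \<eta>"
    using tangent_partial[OF ok_M H.charts_ok sm, of 0 \<eta>]
      linear_0[OF linear_tangent[OF smooth_at_partial1[OF ok_M H.charts_ok sm]]]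
    by (simp add: dcp_mult act_pt pt_dot pt_gam sig_pt)
  then show ?thesis
    by (simp add: left_invariant_def dcp_charts_def dcp_one
        tangent_Pair[OF smooth_at_const H.smooth_left_translation] tangent_const)
qed

text \<open>
  The bracket at the unit differentiates component functions in the directions of the fields
  themselves; for fields tangent to {o} \<times> H only their restrictions to this submanifold enter.
\<close>
lemma dcp_bracket_H: "dcp_bracket P (0, \<eta>) (0, \<zeta>) = (0, h_bracket P \<eta> \<zeta>)"
proof -
  let ?x0 = "chart M (pt P) (pt P)" and ?y0 = "chart H (hone P) (hone P)"
  let ?R = "\<lambda>\<eta>. field_rep (dcp_charts P) (left_invariant (dcp_charts P) (dcp P) (0, \<eta>)) (pt P, hone P)"
  let ?r = "\<lambda>\<eta>. field_rep H (left_invariant H (Hgrp P) \<eta>) (hone P)"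
  have x0: "?x0 \<in> chart M (pt P) ` chart_dom M (pt P)" by (rule chart_in_image[OF ok_M])
  have R: "?R \<eta> (?x0, y) = (0, ?r \<eta> y)" if y: "y \<in> chart H (hone P) ` chart_dom H (hone P)" for \<eta> y
  proof -
    define k where "k = chart_inv H (hone P) y"
    have k: "k \<in> chart_dom H (hone P)" using y by (auto simp: k_def chart_inv_chart[OF H.charts_ok])
    have sm: "smooth_at (M \<times>\<^sub>c H) flat (chart (M \<times>\<^sub>c H) (pt P, hone P)) (pt P, k)"
      using G.atlas k chart_dom_self[OF ok_M] by (simp add: smooth_atlas_def dcp_charts_def)
    have smH: "smooth_at H flat (chart H (hone P)) k"
      using H.atlas k by (simp add: smooth_atlas_def)
    have "?R \<eta> (?x0, y) = tangent (M \<times>\<^sub>c H) flat (chart (M \<times>\<^sub>c H) (pt P, hone P)) (pt P, k)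
        (0, left_invariant H (Hgrp P) \<eta> k)"
      by (simp add: field_rep_def left_invariant_dcp_H k_def dcp_charts_def[of P]
          chart_inv_prod[OF ok_M H.charts_ok x0 y] chart_inv_chart_self[OF ok_M]
          left_invariant_dcp_H[unfolded dcp_charts_def])
    also have "\<dots> = tangent H flat (\<lambda>y. (?x0, chart H (hone P) y)) k (left_invariant H (Hgrp P) \<eta> k)"
      using tangent_partial[OF ok_M H.charts_ok sm, of 0]
        linear_0[OF linear_tangent[OF smooth_at_partial1[OF ok_M H.charts_ok sm]]] by simp
    also have "\<dots> = (0, tangent H flat (chart H (hone P)) k (left_invariant H (Hgrp P) \<eta> k))"
      unfolding flat_prod_flat[symmetric] by (simp add: tangent_Pair[OF smooth_at_const smH] tangent_const)
    finally show ?thesis by (simp add: field_rep_def k_def)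
  qed
  have D: "frechet_derivative (?R \<eta>) (at (?x0, ?y0)) (0, s) = (0, frechet_derivative (?r \<eta>) (at ?y0) s)"
    for \<eta> s
  proof -
    have "(?R \<eta> has_derivative frechet_derivative (?R \<eta>) (at (?x0, ?y0))) (at (?x0, ?y0))"
      using G.field_rep_has_derivative[of "(0, \<eta>)"] by (simp add: dcp_one dcp_charts_def)
    moreover have "((\<lambda>y. (?x0, y)) has_derivative (\<lambda>s. (0, s))) (at ?y0)"
      by (intro has_derivative_Pair has_derivative_ident has_derivative_const)
    ultimately have "((\<lambda>y. ?R \<eta> (?x0, y)) has_derivative
        (\<lambda>s. frechet_derivative (?R \<eta>) (at (?x0, ?y0)) (0, s))) (at ?y0)"
      by (rule has_derivative_compose[rotated])
    then have "((\<lambda>y. (0, ?r \<eta> y)) has_derivative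
        (\<lambda>s. frechet_derivative (?R \<eta>) (at (?x0, ?y0)) (0, s))) (at ?y0)"
      by (rule has_derivative_transform_within_open[OF _ open_chart_image[OF H.charts_ok] chart_in_image[OF H.charts_ok] R])
    moreover have "((\<lambda>y. (0, ?r \<eta> y)) has_derivative (\<lambda>s. (0, frechet_derivative (?r \<eta>) (at ?y0) s))) (at ?y0)"
      by (intro has_derivative_Pair has_derivative_const H.field_rep_has_derivative)
    ultimately show ?thesis
      using has_derivative_unique by metis
  qed
  show ?thesis
    using D by (simp add: dcp_bracket_def lie_bracket_def field_bracket_def dcp_one left_invariant_dcp_H)
      (simp add: dcp_charts_def)
qed

lemma dcp_bracket_decomposition:
  "dcp_bracket P (v, \<eta>) (w, \<zeta>) =
     (v_bracket P v w + inf_act P \<eta> w - inf_act P \<zeta> v,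
      h_bracket P \<eta> \<zeta> + psi P \<eta> w - psi P \<zeta> v + theta P v w)"
proof -
  let ?b = "dcp_bracket P"
  have "?b (v, \<eta>) (w, \<zeta>) = ?b ((v, 0) + (0, \<eta>)) ((w, 0) + (0, \<zeta>))" by simp
  also have "\<dots> = ?b (v, 0) (w, 0) + ?b (v, 0) (0, \<zeta>) + ?b (0, \<eta>) (w, 0) + ?b (0, \<eta>) (0, \<zeta>)"
    unfolding dcp_bracket_def
    by (simp only: linear_add[OF G.linear_lie_bracket_right] linear_add[OF G.linear_lie_bracket_left] add.assoc)
      (simp only: add.left_commute add.commute)
  also have "?b (v, 0) (0, \<zeta>) = - ?b (0, \<zeta>) (v, 0)"
    unfolding dcp_bracket_def by (rule G.lie_bracket_antisymmetric)
  finally show ?thesis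
    by (simp add: dcp_bracket_H v_bracket_def inf_act_def psi_def theta_def prod_eq_iff)
qed

end

section \<open>Dual spaces of direct sums\<close>
lemma dual_map_apply [simp]:
  "bounded_linear f \<Longrightarrow> blinfun_apply (dual_map f \<alpha>) v = blinfun_apply \<alpha> (f v)"
  unfolding dual_map_def
  by (simp add: bounded_linear_Blinfun_apply bounded_linear_compose[OF blinfun.bounded_linear_right])

lemma bounded_linear_dual_map:
  assumes "bounded_linear f"
  shows "bounded_linear (dual_map f)"
proof -
  have "dual_map f = (\<lambda>\<alpha>. \<alpha> o\<^sub>L Blinfun f)"
    by (intro ext blinfun_eqI) (simp add: assms bounded_linear_Blinfun_apply)
  then show ?thesis
    by (simp add: bounded_bilinear.bounded_linear_left[OF bounded_bilinear_blinfun_compose])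
qed

lemma bounded_linear_inl: "bounded_linear (\<lambda>v. (v, 0))"
  and bounded_linear_inr: "bounded_linear (\<lambda>w. (0, w))"
  by (intro bounded_linear_Pair bounded_linear_ident bounded_linear_zero)+

lemma restr_apply [simp]:
  "blinfun_apply (restr1 \<mu>) v = blinfun_apply \<mu> (v, 0)"
  "blinfun_apply (restr2 \<mu>) w = blinfun_apply \<mu> (0, w)"
  by (simp_all add: restr1_def restr2_def bounded_linear_inl bounded_linear_inr)

lemma copair_eq: "copair \<alpha> \<beta> = dual_map fst \<alpha> + dual_map snd \<beta>"
proof -
  have "(\<lambda>(v, w). blinfun_apply \<alpha> v + blinfun_apply \<beta> w) = blinfun_apply (dual_map fst \<alpha> + dual_map snd \<beta>)"
    by (auto simp: blinfun.add_left bounded_linear_fst bounded_linear_snd)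
  then show ?thesis by (simp add: copair_def blinfun_apply_inverse)
qed

lemma copair_apply [simp]: "blinfun_apply (copair \<alpha> \<beta>) (v, w) = blinfun_apply \<alpha> v + blinfun_apply \<beta> w"
  by (simp add: copair_eq blinfun.add_left bounded_linear_fst bounded_linear_snd)

lemma restr_copair [simp]: "restr1 (copair \<alpha> \<beta>) = \<alpha>" "restr2 (copair \<alpha> \<beta>) = \<beta>"
  by (auto intro: blinfun_eqI)

lemma copair_restr [simp]: "copair (restr1 \<mu>) (restr2 \<mu>) = \<mu>"
proof (rule blinfun_eqI)
  fix x
  show "blinfun_apply (copair (restr1 \<mu>) (restr2 \<mu>)) x = blinfun_apply \<mu> x"
    by (cases x) (simp add: blinfun.add_right[symmetric])
qed

lemma bounded_linear_restr: "bounded_linear restr1" "bounded_linear restr2"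
  unfolding restr1_def restr2_def
  by (intro bounded_linear_dual_map bounded_linear_inl bounded_linear_inr)+

lemma has_vector_derivative_copair:
  "((\<lambda>t. copair (\<kappa> t) (l t)) has_vector_derivative D) (at t) \<longleftrightarrow>
     (\<kappa> has_vector_derivative restr1 D) (at t) \<and> (l has_vector_derivative restr2 D) (at t)"
proof
  assume D: "((\<lambda>t. copair (\<kappa> t) (l t)) has_vector_derivative D) (at t)"
  show "(\<kappa> has_vector_derivative restr1 D) (at t) \<and> (l has_vector_derivative restr2 D) (at t)"
    using bounded_linear.has_vector_derivative[OF bounded_linear_restr(1) D]
      bounded_linear.has_vector_derivative[OF bounded_linear_restr(2) D] by simp
next
  assume D: "(\<kappa> has_vector_derivative restr1 D) (at t) \<and> (l has_vector_derivative restr2 D) (at t)"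
  have "((\<lambda>t. dual_map fst (\<kappa> t) + dual_map snd (l t)) has_vector_derivative
      dual_map fst (restr1 D) + dual_map snd (restr2 D)) (at t)"
    using D
    by (intro has_vector_derivative_add bounded_linear.has_vector_derivative[OF bounded_linear_dual_map])
      (simp_all add: bounded_linear_fst bounded_linear_snd)
  then show "((\<lambda>t. copair (\<kappa> t) (l t)) has_vector_derivative D) (at t)"
    by (simp add: copair_eq[symmetric])
qed

lemma has_velocity_prod:
  "has_velocity (A \<times>\<^sub>c B) (\<lambda>t. (c t, d t)) t (v, w) \<longleftrightarrow> has_velocity A c t v \<and> has_velocity B d t w"
proof -
  have cont: "isCont (\<lambda>t. (c t, d t)) t \<longleftrightarrow> isCont c t \<and> isCont d t"
    using isCont_fst[of t "\<lambda>t. (c t, d t)"] isCont_snd[of t "\<lambda>t. (c t, d t)"] by (auto intro: isCont_Pair)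
  have der: "((\<lambda>s. (f s, g s)) has_vector_derivative (v, w)) (at t) \<longleftrightarrow>
      (f has_vector_derivative v) (at t) \<and> (g has_vector_derivative w) (at t)" for f :: "real \<Rightarrow> 'c" and g :: "real \<Rightarrow> 'd"
    using bounded_linear.has_vector_derivative[OF bounded_linear_fst, of "\<lambda>s. (f s, g s)" "(v, w)"]
      bounded_linear.has_vector_derivative[OF bounded_linear_snd, of "\<lambda>s. (f s, g s)" "(v, w)"]
    by (auto intro: has_vector_derivative_Pair)
  show ?thesis
    by (auto simp: has_velocity_def cont comp_def der)
qed

lemma dual_grad_eqI:
  fixes F :: "('v::real_normed_vector \<Rightarrow>\<^sub>L real) \<Rightarrow> real"
  assumes fd: "fin_dim TYPE('v)" and F: "(F has_derivative (\<lambda>\<nu>. blinfun_apply \<nu> \<xi>)) (at \<mu>)"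
  shows "dual_grad F \<mu> = \<xi>"
  unfolding dual_grad_def
proof (rule the_equality[where P = "\<lambda>\<xi>. (F has_derivative (\<lambda>\<nu>. blinfun_apply \<nu> \<xi>)) (at \<mu>)", OF F])
  fix \<zeta> assume "(F has_derivative (\<lambda>\<nu>. blinfun_apply \<nu> \<zeta>)) (at \<mu>)"
  from has_derivative_unique[OF this F] show "\<zeta> = \<xi>"
    by (intro dual_separates_points[OF fd]) (simp add: fun_eq_iff)
qed

text \<open>
  Every derivative on the dual space is evaluation at a vector, so the definite description that
  defines the gradient denotes.
\<close>
lemma has_derivative_dual_grad:
  fixes F :: "('v::real_normed_vector \<Rightarrow>\<^sub>L real) \<Rightarrow> real"
  assumes fd: "fin_dim TYPE('v)" and F: "(F has_derivative D) (at \<mu>)"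
  shows "D = (\<lambda>\<nu>. blinfun_apply \<nu> (dual_grad F \<mu>))"
proof -
  obtain \<xi> where "D = (\<lambda>\<nu>. blinfun_apply \<nu> \<xi>)"
    using bidual_evaluation[OF fd has_derivative_linear[OF F]] by blast
  with dual_grad_eqI[OF fd, of F \<xi> \<mu>] F show ?thesis by simp
qed

lemma dual_grad_direct_sum:
  fixes F :: "('v::real_normed_vector \<Rightarrow>\<^sub>L real) \<Rightarrow> ('w::real_normed_vector \<Rightarrow>\<^sub>L real) \<Rightarrow> real"
  assumes fd: "fin_dim TYPE('v)" "fin_dim TYPE('w)"
    and F: "((\<lambda>(k, l). F k l) has_derivative D) (at (\<alpha>, \<beta>))"
  shows "dual_grad (\<lambda>\<nu>. F (restr1 \<nu>) (restr2 \<nu>)) (copair \<alpha> \<beta>)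
    = (dual_grad (\<lambda>k. F k \<beta>) \<alpha>, dual_grad (\<lambda>l. F \<alpha> l) \<beta>)"
proof (rule dual_grad_eqI[OF fin_dim_prod[OF fd]])
  let ?\<xi> = "dual_grad (\<lambda>k. F k \<beta>) \<alpha>" and ?\<eta> = "dual_grad (\<lambda>l. F \<alpha> l) \<beta>"
  have "((\<lambda>k. (k, \<beta>)) has_derivative (\<lambda>k. (k, 0))) (at \<alpha>)"
    by (intro has_derivative_Pair has_derivative_ident has_derivative_const)
  from has_derivative_compose[OF this F]
  have "((\<lambda>k. F k \<beta>) has_derivative (\<lambda>k. D (k, 0))) (at \<alpha>)" by simp
  from has_derivative_dual_grad[OF fd(1) this] have D1: "D (k, 0) = blinfun_apply k ?\<xi>" for k
    by (simp add: fun_eq_iff)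
  have "((\<lambda>l. (\<alpha>, l)) has_derivative (\<lambda>l. (0, l))) (at \<beta>)"
    by (intro has_derivative_Pair has_derivative_ident has_derivative_const)
  from has_derivative_compose[OF this F]
  have "((\<lambda>l. F \<alpha> l) has_derivative (\<lambda>l. D (0, l))) (at \<beta>)" by simp
  from has_derivative_dual_grad[OF fd(2) this] have D2: "D (0, l) = blinfun_apply l ?\<eta>" for l
    by (simp add: fun_eq_iff)
  have D: "D (restr1 \<nu>, restr2 \<nu>) = blinfun_apply \<nu> (?\<xi>, ?\<eta>)" for \<nu>
  proof -
    have "D (restr1 \<nu>, restr2 \<nu>) = D (restr1 \<nu>, 0) + D (0, restr2 \<nu>)"
      using linear_add[OF has_derivative_linear[OF F], of "(restr1 \<nu>, 0)" "(0, restr2 \<nu>)"] by simp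
    also have "\<dots> = blinfun_apply \<nu> ((?\<xi>, 0) + (0, ?\<eta>))"
      by (simp add: D1 D2 blinfun.add_right[symmetric])
    finally show ?thesis by simp
  qed
  have "((\<lambda>\<nu>. (restr1 \<nu>, restr2 \<nu>)) has_derivative (\<lambda>\<nu>. (restr1 \<nu>, restr2 \<nu>))) (at (copair \<alpha> \<beta>))"
    by (intro has_derivative_Pair bounded_linear_imp_has_derivative bounded_linear_restr)
  from has_derivative_compose[OF this, of "\<lambda>(k, l). F k l" D] F
  show "((\<lambda>\<nu>. F (restr1 \<nu>) (restr2 \<nu>)) has_derivative (\<lambda>\<nu>. blinfun_apply \<nu> (?\<xi>, ?\<eta>))) (at (copair \<alpha> \<beta>))"
    by (simp add: D)
qed

lemma differential_apply:
  "smooth_at A flat F p \<Longrightarrow> blinfun_apply (differential A F p) v = tangent A flat F p v"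
  by (simp add: differential_def bounded_linear_Blinfun_apply bounded_linear_tangent)

lemma differential_prod:
  assumes A: "charts_ok A" and B: "charts_ok B" and F: "smooth_at (A \<times>\<^sub>c B) flat (\<lambda>(x, y). F x y) (p, q)"
  shows "differential (A \<times>\<^sub>c B) (\<lambda>(x, y). F x y) (p, q)
    = copair (differential A (\<lambda>x. F x q) p) (differential B (\<lambda>y. F p y) q)"
proof (rule blinfun_eqI)
  fix z
  show "blinfun_apply (differential (A \<times>\<^sub>c B) (\<lambda>(x, y). F x y) (p, q)) z
    = blinfun_apply (copair (differential A (\<lambda>x. F x q) p) (differential B (\<lambda>y. F p y) q)) z"
    using smooth_at_partial1[OF A B F] smooth_at_partial2[OF A B F]
    by (cases z) (simp add: differential_apply[OF F] differential_apply tangent_partial[OF A B F])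
qed

context cocycle_matched_pair
begin

section \<open>Hamilton's equations\<close>
lemma linear_bracket_components:
  "linear (v_bracket P v)" "linear (\<lambda>w. theta P v w)" "linear (\<lambda>v. inf_act P \<eta> v)" "linear (\<lambda>v. psi P \<eta> v)"
  "linear (\<lambda>\<eta>. inf_act P \<eta> v)" "linear (\<lambda>\<eta>. psi P \<eta> v)"
proof -
  have r1: "linear (\<lambda>w. dcp_bracket P u (w, 0))" for u
    unfolding dcp_bracket_def
    using linear_compose[OF bounded_linear.linear[OF bounded_linear_inl] G.linear_lie_bracket_right]
    by (simp add: comp_def)
  have l2: "linear (\<lambda>\<eta>. dcp_bracket P (0, \<eta>) u)" for u
    unfolding dcp_bracket_def
    using linear_compose[OF bounded_linear.linear[OF bounded_linear_inr] G.linear_lie_bracket_left]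
    by (simp add: comp_def)
  show "linear (v_bracket P v)" "linear (\<lambda>w. theta P v w)" "linear (\<lambda>v. inf_act P \<eta> v)" "linear (\<lambda>v. psi P \<eta> v)"
    "linear (\<lambda>\<eta>. inf_act P \<eta> v)" "linear (\<lambda>\<eta>. psi P \<eta> v)"
    unfolding v_bracket_def[abs_def] theta_def inf_act_def psi_def
    using linear_compose[OF r1 linear_fst] linear_compose[OF r1 linear_snd]
      linear_compose[OF l2 linear_fst] linear_compose[OF l2 linear_snd]
    by (simp_all add: comp_def)
qed

lemmas bounded_linear_M = linear_imp_bounded_linear[OF charts_ok_fin_dim[OF ok_M]]
lemmas bounded_linear_H = linear_imp_bounded_linear[OF charts_ok_fin_dim[OF H.charts_ok]]
lemmas bracket_bounded_linear =
  bounded_linear_M[OF linear_bracket_components(1)] bounded_linear_M[OF linear_bracket_components(2)]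
  bounded_linear_M[OF linear_bracket_components(3)] bounded_linear_M[OF linear_bracket_components(4)]
  bounded_linear_H[OF linear_bracket_components(5)] bounded_linear_H[OF linear_bracket_components(6)]
  bounded_linear_H[OF H.linear_lie_bracket_right]

lemma bounded_linear_dcp_bracket: "bounded_linear (dcp_bracket P u)"
  unfolding dcp_bracket_def
  by (rule linear_imp_bounded_linear[OF charts_ok_fin_dim[OF G.charts_ok] G.linear_lie_bracket_right])

lemma dcp_bracket_zero:
  "inf_act P 0 v = 0" "psi P 0 v = 0" "inf_act P \<eta> 0 = 0" "psi P \<eta> 0 = 0"
  "v_bracket P v 0 = 0" "theta P v 0 = 0" "h_bracket P \<eta> 0 = 0"
  using linear_0[OF linear_bracket_components(5)] linear_0[OF linear_bracket_components(6)]
    linear_0[OF linear_bracket_components(3)] linear_0[OF linear_bracket_components(4)]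
    linear_0[OF linear_bracket_components(1)] linear_0[OF linear_bracket_components(2)]
    linear_0[OF H.linear_lie_bracket_right]
  by simp_all

text \<open>
  Pairing (k, l) with the bracket of (v, \<eta>) and (w, 0), respectively (0, \<zeta>).  In the second case
  the bracket with v is taken in reversed order, which turns the signs of the last two terms.
\<close>
lemma restr_coad:
  "restr1 (coad (dcp_bracket P) (v, \<eta>) (copair k l)) =
     coad (v_bracket P) v k - dual_act P k \<eta> - dual_map (\<lambda>w. psi P \<eta> w) l - dual_map (\<lambda>w. theta P v w) l"
  "restr2 (coad (dcp_bracket P) (v, \<eta>) (copair k l)) =
     coad (h_bracket P) \<eta> l + dual_map (\<lambda>\<zeta>. inf_act P \<zeta> v) k + dual_map (\<lambda>\<zeta>. psi P \<zeta> v) l"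
  by (rule blinfun_eqI, simp add: coad_def dual_act_def bracket_bounded_linear bounded_linear_dcp_bracket
      blinfun.minus_left blinfun.add_left blinfun.diff_left blinfun.add_right blinfun.diff_right blinfun.minus_right
      dcp_bracket_decomposition dcp_bracket_zero)+

text \<open>The transpose of the right translation has the transposed blocks.\<close>
lemma restr_force:
  assumes "TR = tangent (dcp_charts P) (dcp_charts P) (\<lambda>x. x \<otimes>\<^bsub>dcp P\<^esub> (m, h)) \<one>\<^bsub>dcp P\<^esub>"
  shows "restr1 (dual_map TR (copair a b)) =
      dual_map (tangent M M (\<lambda>n. n \<cdot> m) (pt P)) a + dual_map (tangent M H (\<lambda>n. gam P n m \<star> h) (pt P)) b"
    and "restr2 (dual_map TR (copair a b)) =
      dual_map (tangent H M (\<lambda>k. k \<triangleright> m) (hone P)) a + dual_map (tangent H H (\<lambda>k. sig P k m \<star> h) (hone P)) b"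
proof -
  note bl = bounded_linear_tangent[OF smooth_at_dot1] bounded_linear_tangent[OF smooth_at_gam_mult]
    bounded_linear_tangent[OF smooth_at_act1] bounded_linear_tangent[OF smooth_at_sig_mult]
  have TR: "bounded_linear TR"
    unfolding assms by (rule bounded_linear_tangent[OF G.smooth_right_translation])
  show "restr1 (dual_map TR (copair a b)) =
      dual_map (tangent M M (\<lambda>n. n \<cdot> m) (pt P)) a + dual_map (tangent M H (\<lambda>n. gam P n m \<star> h) (pt P)) b"
    by (rule blinfun_eqI)
      (simp add: TR bl blinfun.add_left, simp add: assms tangent_right_translation
        bl[THEN bounded_linear.linear, THEN linear_0])
  show "restr2 (dual_map TR (copair a b)) =
      dual_map (tangent H M (\<lambda>k. k \<triangleright> m) (hone P)) a + dual_map (tangent H H (\<lambda>k. sig P k m \<star> h) (hone P)) b"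
    by (rule blinfun_eqI)
      (simp add: TR bl blinfun.add_left, simp add: assms tangent_right_translation
        bl[THEN bounded_linear.linear, THEN linear_0])
qed

text \<open>
  Since \<gamma>(o, m) = 1 = \<sigma>(1, m), both maps into H followed by right translation by h have tangent maps
  that factor through the tangent map of right translation at the unit of H.
\<close>
lemma tangent_right_translation_velocity:
  "tangent (dcp_charts P) (dcp_charts P) (\<lambda>x. x \<otimes>\<^bsub>dcp P\<^esub> (m, h)) \<one>\<^bsub>dcp P\<^esub> (v, \<eta>) =
    (tangent M M (\<lambda>n. n \<cdot> m) (pt P) v + inf_act_pt P \<eta> m,
     tangent H H (\<lambda>k. k \<star> h) (hone P)
       (tangent M H (\<lambda>n. gam P n m) (pt P) v + tangent H H (\<lambda>k. sig P k m) (hone P) \<eta>))"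
proof -
  have "tangent M H (\<lambda>n. gam P n m \<star> h) (pt P) v
      = tangent H H (\<lambda>k. k \<star> h) (hone P) (tangent M H (\<lambda>n. gam P n m) (pt P) v)"
    using tangent_compose[OF ok_M H.charts_ok smooth_at_gam1 H.smooth_right_translation]
    by (simp add: pt_gam)
  moreover have "tangent H H (\<lambda>k. sig P k m \<star> h) (hone P) \<eta>
      = tangent H H (\<lambda>k. k \<star> h) (hone P) (tangent H H (\<lambda>k. sig P k m) (hone P) \<eta>)"
    using tangent_compose[OF H.charts_ok H.charts_ok smooth_at_sig1 H.smooth_right_translation]
    by (simp add: sig_one)
  ultimately show ?thesis
    by (simp add: tangent_right_translation inf_act_pt_def
        linear_add[OF linear_tangent[OF H.smooth_right_translation]])
qed

text \<open>
  The derivatives along the factors exist jointly because the Hamiltonian is smooth on the product of all four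
  spaces; the splittings for direct sums and for products of charts apply to its restrictions with the
  group element or the momenta held fixed.
\<close>
lemma hamiltonian_derivatives:
  fixes \<H> :: "('e \<Rightarrow>\<^sub>L real) \<Rightarrow> ('f \<Rightarrow>\<^sub>L real) \<Rightarrow> 'm \<Rightarrow> 'h \<Rightarrow> real"
  assumes "smooth_map (flat \<times>\<^sub>c flat \<times>\<^sub>c M \<times>\<^sub>c H) flat (\<lambda>(k, l, x, y). \<H> k l x y)"
  shows "dual_grad (\<lambda>\<nu>. \<H> (restr1 \<nu>) (restr2 \<nu>) m h) (copair k l)
      = (dual_grad (\<lambda>k. \<H> k l m h) k, dual_grad (\<lambda>l. \<H> k l m h) l)"
    and "differential (dcp_charts P) (\<lambda>(x, y). \<H> k l x y) (m, h)
      = copair (differential M (\<lambda>x. \<H> k l x h) m) (differential H (\<lambda>y. \<H> k l m y) h)"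
proof -
  note fdM = charts_ok_fin_dim[OF ok_M] and fdH = charts_ok_fin_dim[OF H.charts_ok]
  have okK: "charts_ok (flat :: ('e \<Rightarrow>\<^sub>L real, 'e \<Rightarrow>\<^sub>L real) charts)"
    by (rule charts_ok_flat[OF fin_dim_dual[OF fdM]])
  have okL: "charts_ok (flat :: ('f \<Rightarrow>\<^sub>L real, 'f \<Rightarrow>\<^sub>L real) charts)"
    by (rule charts_ok_flat[OF fin_dim_dual[OF fdH]])
  have okR: "charts_ok (flat :: (real, real) charts)"
    by (rule charts_ok_flat) (auto simp: fin_dim_def intro!: exI[of _ "{1}"] simp: span_singleton)
  note okLMH = charts_ok_prod[OF okL ok_MH]
  note okKLMH = charts_ok_prod[OF okK okLMH]
  have sm: "smooth_at (flat \<times>\<^sub>c flat \<times>\<^sub>c M \<times>\<^sub>c H) flat (\<lambda>(k, l, x, y). \<H> k l x y) z" for z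
    by (rule smooth_map_imp_smooth_at[OF okKLMH okR assms])
  have "smooth_at (M \<times>\<^sub>c H) flat (\<lambda>(x, y). \<H> k l x y) (m, h)"
    using smooth_at_partial2[OF okL ok_MH smooth_at_partial2[OF okK okLMH sm]] by simp
  from differential_prod[OF ok_M H.charts_ok this]
  show "differential (dcp_charts P) (\<lambda>(x, y). \<H> k l x y) (m, h)
      = copair (differential M (\<lambda>x. \<H> k l x h) m) (differential H (\<lambda>y. \<H> k l m y) h)"
    by (simp add: dcp_charts_def)
  have "smooth_at (flat \<times>\<^sub>c flat) (flat \<times>\<^sub>c flat \<times>\<^sub>c M \<times>\<^sub>c H)
      (\<lambda>z::('e \<Rightarrow>\<^sub>L real) \<times> ('f \<Rightarrow>\<^sub>L real). (fst z, snd z, m, h)) (k, l)"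
    by (rule smooth_at_Pair[OF smooth_at_fst[OF okK okL]
          smooth_at_Pair[OF smooth_at_snd[OF okK okL] smooth_at_Pair[OF smooth_at_const smooth_at_const]]])
  from smooth_at_compose[OF charts_ok_prod[OF okK okL] okKLMH this sm]
  have "smooth_at flat flat (\<lambda>z. \<H> (fst z) (snd z) m h) (k, l)"
    by (simp add: flat_prod_flat)
  from has_derivative_tangent[OF this]
  have "((\<lambda>(k, l). \<H> k l m h) has_derivative tangent flat flat (\<lambda>z. \<H> (fst z) (snd z) m h) (k, l)) (at (k, l))"
    by (simp add: comp_def case_prod_unfold)
  from dual_grad_direct_sum[OF fdM fdH this]
  show "dual_grad (\<lambda>\<nu>. \<H> (restr1 \<nu>) (restr2 \<nu>) m h) (copair k l)
      = (dual_grad (\<lambda>k. \<H> k l m h) k, dual_grad (\<lambda>l. \<H> k l m h) l)" .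
qed

end

theorem proposition4p3:
  fixes P :: "('m::{t2_space, second_countable_topology}, 'e::real_normed_vector,
               'h::{t2_space, second_countable_topology}, 'f::real_normed_vector) matched_pair"
    and \<H> :: "('e \<Rightarrow>\<^sub>L real) \<Rightarrow> ('f \<Rightarrow>\<^sub>L real) \<Rightarrow> 'm \<Rightarrow> 'h \<Rightarrow> real"
    and I :: "real set"
    and \<kappa> :: "real \<Rightarrow> ('e \<Rightarrow>\<^sub>L real)" and lam :: "real \<Rightarrow> ('f \<Rightarrow>\<^sub>L real)"
    and m :: "real \<Rightarrow> 'm" and h :: "real \<Rightarrow> 'h"
  assumes "cocycle_matched_pair P"
    and "smooth_map (flat \<times>\<^sub>c flat \<times>\<^sub>c Mchts P \<times>\<^sub>c Hchts P) flat (\<lambda>(k, l, x, y). \<H> k l x y)"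
    and "open I"
  shows "hamilton_solution (dcp_charts P) (dcp P)
           (\<lambda>\<mu> (x, y). \<H> (restr1 \<mu>) (restr2 \<mu>) x y) I
           (\<lambda>t. copair (\<kappa> t) (lam t)) (\<lambda>t. (m t, h t)) \<longleftrightarrow>
    (\<forall>t\<in>I.
      let M = Mchts P; H = Hchts P;
          d\<kappa> = dual_grad (\<lambda>k. \<H> k (lam t) (m t) (h t)) (\<kappa> t);
          dlam = dual_grad (\<lambda>l. \<H> (\<kappa> t) l (m t) (h t)) (lam t);
          dm = differential M (\<lambda>x. \<H> (\<kappa> t) (lam t) x (h t)) (m t);
          dh = differential H (\<lambda>y. \<H> (\<kappa> t) (lam t) (m t) y) (h t)
      in (\<kappa> has_vector_derivative
            (- dual_map (tangent M M (\<lambda>n. n \<cdot>\<^bsub>P\<^esub> m t) (pt P)) dm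
             - dual_map (tangent M H (\<lambda>n. gam P n (m t) \<star>\<^bsub>P\<^esub> h t) (pt P)) dh
             + coad (v_bracket P) d\<kappa> (\<kappa> t)
             - dual_act P (\<kappa> t) dlam
             - dual_map (\<lambda>v. psi P dlam v) (lam t)
             - dual_map (\<lambda>w. theta P d\<kappa> w) (lam t))) (at t) \<and>
         (lam has_vector_derivative
            (- dual_map (tangent H M (\<lambda>k. k \<triangleright>\<^bsub>P\<^esub> m t) (hone P)) dm
             - dual_map (tangent H H (\<lambda>k. sig P k (m t) \<star>\<^bsub>P\<^esub> h t) (hone P)) dh
             + coad (h_bracket P) dlam (lam t)
             + dual_map (\<lambda>\<eta>. inf_act P \<eta> d\<kappa>) (\<kappa> t)
             + dual_map (\<lambda>\<eta>. psi P \<eta> d\<kappa>) (lam t))) (at t) \<and>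
         has_velocity M m t
           (tangent M M (\<lambda>n. n \<cdot>\<^bsub>P\<^esub> m t) (pt P) d\<kappa> + inf_act_pt P dlam (m t)) \<and>
         has_velocity H h t
           (tangent H H (\<lambda>k. k \<star>\<^bsub>P\<^esub> h t) (hone P)
              (tangent M H (\<lambda>n. gam P n (m t)) (pt P) d\<kappa> +
               tangent H H (\<lambda>k. sig P k (m t)) (hone P) dlam)))"
proof -
  interpret cocycle_matched_pair P by (rule assms(1))
  note D = hamiltonian_derivatives[OF assms(2)]
  note lin = bounded_linear.linear[OF bounded_linear_restr(1)] bounded_linear.linear[OF bounded_linear_restr(2)]
  have velocity: "has_velocity (dcp_charts P) (\<lambda>t. (m t, h t)) t (v, \<eta>) \<longleftrightarrow>
      has_velocity (Mchts P) m t v \<and> has_velocity (Hchts P) h t \<eta>" for t v \<eta>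
    by (simp add: dcp_charts_def has_velocity_prod)
  \<comment> \<open>The linear maps \<open>restr1\<close> and \<open>restr2\<close> extract from the momentum equation its two components;
    they agree with the asserted right-hand sides up to the order of the summands.\<close>
  show ?thesis
    unfolding hamilton_solution_def Let_def dcp_bracket_def[symmetric]
    by (intro ball_cong refl)
      (simp add: D has_vector_derivative_copair velocity tangent_right_translation_velocity
        linear_diff[OF lin(1)] linear_diff[OF lin(2)] restr_coad restr_force[OF refl] algebra_simps)
qed

end
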